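(* Let $M^2$ be a Riemannian $2$-manifold with (not necessarily constant) Gaussian curvature $K$, let $\Omega\subset M^2$ be a domain and let $u:\Omega\to\mathbb{R}$ be a harmonic function with no critical points in $\Omega$. Let $k$ be the curvature of the level curves of $u$ and $h$ the curvature of the curves of steepest descent of $u$. Then the function $\phi=\frac{k}{|\nabla u|}$ satisfies $$\Delta\phi+2K\phi=\frac{\langle\nabla K,\nabla u\rangle}{|\nabla u|^2},$$ and $$\Delta\left(\frac{h}{|\nabla u|}\right)+2K\frac{h}{|\nabla u|}=-\frac{\langle\nabla K,\star\nabla u\rangle}{|\nabla u|^2}.$$ Moreover, $$-\Delta\ln|k|\ \ge\ K-\frac{1}{|k|}\left\langle\nabla K,\frac{\nabla u}{|\nabla u|}\right\rangle\qquad\text{at points where } k\ne 0,$$ and $$-\Delta\ln|h|\ \ge\ K+\frac{1}{|h|}\left\langle\nabla K,\frac{\star\nabla u}{|\nabla u|}\right\rangle\qquad\text{at points where } h\ne 0.$$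
   Context: $\Delta$ is the Laplace--Beltrami operator. The curvatures are defined by $$k:=-\operatorname{div}\left(\frac{\nabla u}{|\nabla u|}\right),\qquad h:=\operatorname{div}\left(\frac{\star\nabla u}{|\nabla u|}\right),$$ where $\star$ is the Hodge star operator acting on tangent vectors. In a local (oriented) orthonormal frame $\{e_1,e_2\}$, with $u_i=e_i(u)$, one has $\star\nabla u=(-u_2,u_1)$ and hence $h=-\operatorname{div}\left(\frac{(u_2,-u_1)}{|\nabla u|}\right)$.
   Formalization: In the two inequalities the factors 1/|k| and 1/|h| on the right are replaced by 1/k and 1/h (ln|k|, ln|h| are kept), since the printed form fails in general where k<0 or h<0; for k>0, h>0 nothing changes. *)

theory Defs
  imports "HOL-Analysis.Analysis"
begin

section \<open>Smooth functions on open subsets of the plane\<close>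

primrec Ck_on :: "nat \<Rightarrow> (real^2) set \<Rightarrow> (real^2 \<Rightarrow> 'b::real_normed_vector) \<Rightarrow> bool" where
  "Ck_on 0 S f \<longleftrightarrow> continuous_on S f"
| "Ck_on (Suc n) S f \<longleftrightarrow>
     f differentiable_on S \<and>
     (\<forall>i. Ck_on n S (\<lambda>x. frechet_derivative f (at x) (axis i 1)))"

text \<open>Only meant for open \<open>S\<close>.\<close>

definition smooth_on :: "(real^2) set \<Rightarrow> (real^2 \<Rightarrow> 'b::real_normed_vector) \<Rightarrow> bool" where
  "smooth_on S f \<longleftrightarrow> (\<forall>n. Ck_on n S f)"

section \<open>Charts and Riemannian surfaces\<close>

record 'a chart =
  cdom :: "'a set"
  cmap :: "'a \<Rightarrow> real^2"

definition chart_inv :: "'a chart \<Rightarrow> real^2 \<Rightarrow> 'a" where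
  "chart_inv c = inv_into (cdom c) (cmap c)"

definition chart_jacobian :: "'a chart \<Rightarrow> 'a chart \<Rightarrow> 'a \<Rightarrow> real^2^2" where
  "chart_jacobian c c' p =
     matrix (frechet_derivative (cmap c' \<circ> chart_inv c) (at (cmap c p)))"

definition smooth_in_chart ::
  "'a chart \<Rightarrow> 'a set \<Rightarrow> ('a \<Rightarrow> 'b::real_normed_vector) \<Rightarrow> bool" where
  "smooth_in_chart c W f \<longleftrightarrow> smooth_on (cmap c ` (W \<inter> cdom c)) (f \<circ> chart_inv c)"

text \<open>
  The metric is given by its coefficient matrix in each chart: \<open>g c p $ i $ j\<close> is the inner
  product of the coordinate vectors \<open>i\<close> and \<open>j\<close> of the chart \<open>c\<close> at \<open>p\<close>. These matrices transform
  as a covariant 2-tensor. The atlas \<open>A\<close> need be neither maximal nor oriented.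
\<close>

locale riemannian_surface =
  fixes M :: "'a topology"
    and A :: "'a chart set"
    and g :: "'a chart \<Rightarrow> 'a \<Rightarrow> real^2^2"
  assumes hausdorff: "Hausdorff_space M"
    and second_countable: "second_countable M"
    and atlas_cover: "(\<Union>c\<in>A. cdom c) = topspace M"
    and chart_dom_open: "c \<in> A \<Longrightarrow> openin M (cdom c)"
    and chart_image_open: "c \<in> A \<Longrightarrow> open (cmap c ` cdom c)"
    and chart_homeomorphic: "c \<in> A \<Longrightarrow>
      homeomorphic_map (subtopology M (cdom c)) (top_of_set (cmap c ` cdom c)) (cmap c)"
    and chart_compatible: "c \<in> A \<Longrightarrow> c' \<in> A \<Longrightarrow> smooth_in_chart c (cdom c') (cmap c')"
    and metric_smooth: "c \<in> A \<Longrightarrow> smooth_in_chart c (cdom c) (g c)"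
    and metric_symmetric: "c \<in> A \<Longrightarrow> p \<in> cdom c \<Longrightarrow> transpose (g c p) = g c p"
    and metric_positive: "c \<in> A \<Longrightarrow> p \<in> cdom c \<Longrightarrow> X \<noteq> 0 \<Longrightarrow> X \<bullet> (g c p *v X) > 0"
    and metric_transform: "c \<in> A \<Longrightarrow> c' \<in> A \<Longrightarrow> p \<in> cdom c \<inter> cdom c' \<Longrightarrow>
      g c p = transpose (chart_jacobian c c' p) ** g c' p ** chart_jacobian c c' p"

section \<open>Differential operators in a chart\<close>

text \<open>
  Functions live on the surface; a vector field is represented by its components in the
  coordinate frame of the chart \<open>c\<close>. All operators are the usual coordinate expressions of
  chart-independent objects, except that \<open>hodge\<close> and \<open>descent_curvature\<close> change sign with the
  orientation of \<open>c\<close>.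
\<close>

definition pd :: "'a chart \<Rightarrow> 2 \<Rightarrow> ('a \<Rightarrow> real) \<Rightarrow> 'a \<Rightarrow> real" where
  "pd c i f p = frechet_derivative (f \<circ> chart_inv c) (at (cmap c p)) (axis i 1)"

context
  fixes g :: "'a chart \<Rightarrow> 'a \<Rightarrow> real^2^2" and c :: "'a chart"
begin

definition ginner :: "'a \<Rightarrow> real^2 \<Rightarrow> real^2 \<Rightarrow> real" where
  "ginner p X Y = X \<bullet> (g c p *v Y)"

definition gnorm :: "'a \<Rightarrow> real^2 \<Rightarrow> real" where
  "gnorm p X = sqrt (ginner p X X)"

definition vol :: "'a \<Rightarrow> real" where
  "vol p = sqrt (det (g c p))"

definition grad :: "('a \<Rightarrow> real) \<Rightarrow> 'a \<Rightarrow> real^2" where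
  "grad f p = matrix_inv (g c p) *v (\<chi> i. pd c i f p)"

definition divergence :: "('a \<Rightarrow> real^2) \<Rightarrow> 'a \<Rightarrow> real" where
  "divergence X p = (\<Sum>i\<in>UNIV. pd c i (\<lambda>q. vol q * X q $ i) p) / vol p"

definition laplacian :: "('a \<Rightarrow> real) \<Rightarrow> 'a \<Rightarrow> real" where
  "laplacian f = divergence (grad f)"

text \<open>
  Rotation by a positive right angle for the orientation in which the chart \<open>c\<close> is positive,
  i.e. the inner product of \<open>hodge p X\<close> and \<open>Y\<close> is
  \<open>vol p * (X $ 1 * Y $ 2 - X $ 2 * Y $ 1)\<close>. On an oriented orthonormal frame it sends
  \<open>(a, b)\<close> to \<open>(-b, a)\<close>.
\<close>

definition hodge :: "'a \<Rightarrow> real^2 \<Rightarrow> real^2" where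
  "hodge p X = (1 / vol p) *\<^sub>R
     vector [ - (g c p $ 1 $ 2 * X $ 1 + g c p $ 2 $ 2 * X $ 2),
              g c p $ 1 $ 1 * X $ 1 + g c p $ 1 $ 2 * X $ 2 ]"

text \<open>\<open>christoffel k i j\<close> has upper index \<open>k\<close> and lower indices \<open>i\<close>, \<open>j\<close>.\<close>

definition christoffel :: "2 \<Rightarrow> 2 \<Rightarrow> 2 \<Rightarrow> 'a \<Rightarrow> real" where
  "christoffel k i j p = (\<Sum>l\<in>UNIV. matrix_inv (g c p) $ k $ l *
     (pd c i (\<lambda>q. g c q $ j $ l) p + pd c j (\<lambda>q. g c q $ i $ l) p
      - pd c l (\<lambda>q. g c q $ i $ j) p)) / 2"

text \<open>
  Component \<open>l\<close> of \<open>R(d\<^sub>i, d\<^sub>j) d\<^sub>k\<close>, with the sign convention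
  \<open>R(X, Y) Z = D\<^sub>X D\<^sub>Y Z - D\<^sub>Y D\<^sub>X Z - D\<^bsub>[X, Y]\<^esub> Z\<close>.
\<close>

definition riemann :: "2 \<Rightarrow> 2 \<Rightarrow> 2 \<Rightarrow> 2 \<Rightarrow> 'a \<Rightarrow> real" where
  "riemann l k i j p =
     pd c i (christoffel l j k) p - pd c j (christoffel l i k) p
     + (\<Sum>m\<in>UNIV. christoffel l i m p * christoffel m j k p
                - christoffel l j m p * christoffel m i k p)"

text \<open>The sectional curvature \<open>\<langle>R(d\<^sub>1, d\<^sub>2) d\<^sub>2, d\<^sub>1\<rangle> / det g\<close>, equal to \<open>1\<close> on the unit sphere.\<close>

definition gauss_curvature :: "'a \<Rightarrow> real" where
  "gauss_curvature p = (\<Sum>l\<in>UNIV. g c p $ 1 $ l * riemann l 2 1 2 p) / det (g c p)"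

definition level_curvature :: "('a \<Rightarrow> real) \<Rightarrow> 'a \<Rightarrow> real" where
  "level_curvature u p =
     - divergence (\<lambda>q. (1 / gnorm q (grad u q)) *\<^sub>R grad u q) p"

definition descent_curvature :: "('a \<Rightarrow> real) \<Rightarrow> 'a \<Rightarrow> real" where
  "descent_curvature u p =
     divergence (\<lambda>q. (1 / gnorm q (grad u q)) *\<^sub>R hodge q (grad u q)) p"

end

text \<open>Harmonic functions are smooth by definition here; elliptic regularity is not invoked.\<close>

definition harmonic_on ::
  "'a chart set \<Rightarrow> ('a chart \<Rightarrow> 'a \<Rightarrow> real^2^2) \<Rightarrow> 'a set \<Rightarrow> ('a \<Rightarrow> real) \<Rightarrow> bool" where
  "harmonic_on A g \<Omega> u \<longleftrightarrow>
     (\<forall>c\<in>A. smooth_in_chart c \<Omega> u \<and> (\<forall>p\<in>\<Omega> \<inter> cdom c. laplacian g c u p = 0))"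

definition critical_point :: "'a chart set \<Rightarrow> ('a \<Rightarrow> real) \<Rightarrow> 'a \<Rightarrow> bool" where
  "critical_point A u p \<longleftrightarrow> (\<exists>c\<in>A. p \<in> cdom c \<and> (\<forall>i. pd c i u p = 0))"

end

theory Submission
  imports Defs
begin

text \<open>
  Locally \<open>u\<close> has a harmonic conjugate \<open>v\<close>, and \<open>(u, v)\<close> are isothermal coordinates: the metric is
  \<open>(du\<^sup>2 + dv\<^sup>2) / N\<^sup>2\<close> with \<open>N = |\<nabla>u|\<close>. In these coordinates the Laplacian is
  \<open>\<Delta> = N\<^sup>2 (\<partial>\<^sub>u\<^sup>2 + \<partial>\<^sub>v\<^sup>2)\<close>, and the curvature formula for conformal metrics reads
  \<open>K = \<Delta> ln N\<close>. The fields \<open>\<nabla>u\<close> and \<open>\<star>\<nabla>u\<close> are divergence-free, so the definitions of the two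
  curvatures reduce to \<open>k / N = \<partial>\<^sub>u ln N\<close> and \<open>h / N = - \<partial>\<^sub>v ln N\<close>. Now apply \<open>\<partial>\<^sub>u\<close> to
  \<open>(\<partial>\<^sub>u\<^sup>2 + \<partial>\<^sub>v\<^sup>2) ln N = K / N\<^sup>2\<close> and multiply by \<open>N\<^sup>2\<close>:
  \<open>\<Delta>(k / N) = \<partial>\<^sub>u K - 2 K \<partial>\<^sub>u ln N\<close>, which is the first identity, since \<open>\<partial>\<^sub>u = \<nabla>u / N\<^sup>2\<close>. Applying
  \<open>\<partial>\<^sub>v\<close> gives the second one. For the inequalities write \<open>\<phi> = k / N\<close>, so that
  \<open>\<Delta> ln |k| = \<Delta> ln N + \<Delta> ln |\<phi>| = K + \<Delta>\<phi> / \<phi> - |\<nabla>\<phi>|\<^sup>2 / \<phi>\<^sup>2\<close>, drop the square, and insert the first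
  identity; likewise for \<open>h\<close>.

  Changing to these coordinates would require the invariance of every operator, in particular of
  the curvature tensor. This is avoided by staying in the given chart and using only the closed
  1-form \<open>\<star>du\<close> in place of \<open>dv\<close> and the vector fields \<open>U = \<nabla>u / N\<^sup>2\<close>, \<open>V = \<star>\<nabla>u / N\<^sup>2\<close> in place of
  \<open>\<partial>\<^sub>u, \<partial>\<^sub>v\<close>. The proof is carried by four facts: \<open>U\<close> and \<open>V\<close> commute (\<open>along_UV_commute\<close>), the form
  of the Laplacian (\<open>laplacian_UV\<close>), the expression of the curvature tensor through the connection
  form of an orthonormal coframe (\<open>gauss_curvature_coframe\<close>), and its consequence \<open>K = \<Delta> ln N\<close>
  (\<open>gauss_curvature_eq_laplacian\<close>).
\<close>

section \<open>Calculus of smooth functions on open subsets of the plane\<close>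

abbreviation partial :: "2 \<Rightarrow> (real^2 \<Rightarrow> 'b::real_normed_vector) \<Rightarrow> real^2 \<Rightarrow> 'b" where
  "partial i f x \<equiv> frechet_derivative f (at x) (axis i 1)"

lemma partial_eqI: "(f has_derivative f') (at x) \<Longrightarrow> partial i f x = f' (axis i 1)"
  by (simp flip: frechet_derivative_at)

lemma partial_cong:
  assumes "open S" "x \<in> S" "\<And>y. y \<in> S \<Longrightarrow> f y = g y"
  shows "partial i f x = partial i g x"
proof -
  have "(f has_derivative f') (at x) \<longleftrightarrow> (g has_derivative f') (at x)" for f'
    using has_derivative_transform_within_open[OF _ assms(1,2), of f f' UNIV g]
      has_derivative_transform_within_open[OF _ assms(1,2), of g f' UNIV f] assms(3) by auto
  thus ?thesis by (simp add: frechet_derivative_def)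
qed

lemma Ck_on_cong:
  assumes "open S" "\<And>y. y \<in> S \<Longrightarrow> f y = g y"
  shows "Ck_on n S f \<longleftrightarrow> Ck_on n S g"
  using assms(2)
proof (induction n arbitrary: f g)
  case 0
  thus ?case by (simp cong: continuous_on_cong)
next
  case (Suc n)
  have "f differentiable_on S \<longleftrightarrow> g differentiable_on S"
    using has_derivative_transform[of _ S f g] has_derivative_transform[of _ S g f] Suc.prems
    unfolding differentiable_on_def differentiable_def by metis
  moreover have "Ck_on n S (partial i f) \<longleftrightarrow> Ck_on n S (partial i g)" for i
    by (rule Suc.IH) (rule partial_cong[OF assms(1)], auto simp: Suc.prems)
  ultimately show ?case by simp
qed

lemma Ck_on_SucD: "Ck_on (Suc n) S f \<Longrightarrow> Ck_on n S f"
  by (induction n arbitrary: f) (auto simp: differentiable_imp_continuous_on)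

lemma Ck_on_subset: "Ck_on n S f \<Longrightarrow> T \<subseteq> S \<Longrightarrow> Ck_on n T f"
  by (induction n arbitrary: f) (auto intro: continuous_on_subset differentiable_on_subset)

lemma Ck_on_differentiable:
  "open S \<Longrightarrow> Ck_on (Suc n) S f \<Longrightarrow> x \<in> S \<Longrightarrow> f differentiable (at x)"
  by (simp add: differentiable_on_eq_differentiable_at)

text \<open>The inductive step shared by the closure properties below: it suffices to know the
  partial derivatives up to equality on \<open>S\<close>.\<close>

lemma Ck_on_SucI:
  assumes "open S" "\<And>x. x \<in> S \<Longrightarrow> (f has_derivative f' x) (at x)"
    and "\<And>i. Ck_on n S (\<lambda>x. f' x (axis i 1))"
  shows "Ck_on (Suc n) S f"
proof -
  have "f differentiable_on S"
    using assms(1,2) by (auto simp: differentiable_on_eq_differentiable_at differentiable_def)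
  moreover have "Ck_on n S (partial i f)" for i
    using assms(3)[of i] Ck_on_cong[OF assms(1), of "partial i f" "\<lambda>x. f' x (axis i 1)"]
    by (simp add: partial_eqI[OF assms(2)])
  ultimately show ?thesis by simp
qed

lemma Ck_on_const: "Ck_on n S (\<lambda>x. b)"
  by (induction n arbitrary: b) auto

lemma Ck_on_bounded_linear:
  assumes "open S" "bounded_linear L" "Ck_on n S f"
  shows "Ck_on n S (\<lambda>x. L (f x))"
  using assms(3)
proof (induction n arbitrary: f)
  case 0
  thus ?case using assms(2) by (simp add: bounded_linear.continuous_on)
next
  case (Suc n)
  show ?case
  proof (rule Ck_on_SucI[OF assms(1)])
    fix x assume "x \<in> S"
    with Suc.prems have "f differentiable (at x)" by (rule Ck_on_differentiable[OF assms(1)])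
    thus "((\<lambda>x. L (f x)) has_derivative (\<lambda>v. L (frechet_derivative f (at x) v))) (at x)"
      using bounded_linear.has_derivative[OF assms(2)] by (auto simp: frechet_derivative_works)
  qed (use Suc in auto)
qed

lemma Ck_on_add:
  assumes "open S" "Ck_on n S f" "Ck_on n S g"
  shows "Ck_on n S (\<lambda>x. f x + g x)"
  using assms(2,3)
proof (induction n arbitrary: f g)
  case 0
  thus ?case by (simp add: continuous_on_add)
next
  case (Suc n)
  show ?case
  proof (rule Ck_on_SucI[OF assms(1)])
    fix x assume "x \<in> S"
    with Suc.prems have "f differentiable (at x)" "g differentiable (at x)"
      by (auto intro: Ck_on_differentiable[OF assms(1)])
    thus "((\<lambda>x. f x + g x) has_derivative
        (\<lambda>v. frechet_derivative f (at x) v + frechet_derivative g (at x) v)) (at x)"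
      by (auto simp: frechet_derivative_works intro: has_derivative_add)
  qed (use Suc in auto)
qed

lemma Ck_on_mult:
  fixes f g :: "real^2 \<Rightarrow> real"
  assumes "open S" "Ck_on n S f" "Ck_on n S g"
  shows "Ck_on n S (\<lambda>x. f x * g x)"
  using assms(2,3)
proof (induction n arbitrary: f g)
  case 0
  thus ?case by (simp add: continuous_on_mult)
next
  case (Suc n)
  show ?case
  proof (rule Ck_on_SucI[OF assms(1)])
    fix x assume "x \<in> S"
    with Suc.prems have "f differentiable (at x)" "g differentiable (at x)"
      by (auto intro: Ck_on_differentiable[OF assms(1)])
    thus "((\<lambda>x. f x * g x) has_derivative
        (\<lambda>v. f x * frechet_derivative g (at x) v + frechet_derivative f (at x) v * g x)) (at x)"
      by (auto simp: frechet_derivative_works intro: has_derivative_mult)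
  next
    fix i show "Ck_on n S (\<lambda>x. f x * partial i g x + partial i f x * g x)"
      using Suc.prems Ck_on_SucD[of n S f] Ck_on_SucD[of n S g]
      by (intro Ck_on_add[OF assms(1)] Suc.IH) auto
  qed
qed

lemma Ck_on_inverse:
  fixes f :: "real^2 \<Rightarrow> real"
  assumes "open S" "\<And>x. x \<in> S \<Longrightarrow> f x \<noteq> 0" "Ck_on n S f"
  shows "Ck_on n S (\<lambda>x. inverse (f x))"
  using assms(3)
proof (induction n)
  case 0
  thus ?case using assms(2) by (auto intro: continuous_on_inverse)
next
  case (Suc n)
  show ?case
  proof (rule Ck_on_SucI[OF assms(1)])
    fix x assume x: "x \<in> S"
    with Suc.prems have "f differentiable (at x)" by (rule Ck_on_differentiable[OF assms(1)])
    thus "((\<lambda>x. inverse (f x)) has_derivative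
        (\<lambda>v. - (inverse (f x) * frechet_derivative f (at x) v * inverse (f x)))) (at x)"
      using assms(2)[OF x] by (auto simp: frechet_derivative_works intro: has_derivative_inverse)
  next
    fix i
    have "Ck_on n S (\<lambda>x. inverse (f x) * partial i f x * inverse (f x))"
      using Suc.prems Ck_on_SucD[OF Suc.prems] Suc.IH
      by (intro Ck_on_mult[OF assms(1)]) auto
    from Ck_on_bounded_linear[OF assms(1) bounded_linear_minus[OF bounded_linear_ident] this]
    show "Ck_on n S (\<lambda>x. - (inverse (f x) * partial i f x * inverse (f x)))" .
  qed
qed

text \<open>Square root and logarithm of a positive function have derivatives \<open>f' / (2 * sqrt f)\<close>
  and \<open>f' / f\<close>, so that their regularity bootstraps from that of inverses.\<close>

lemma Ck_on_sqrt:
  fixes f :: "real^2 \<Rightarrow> real"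
  assumes "open S" "\<And>x. x \<in> S \<Longrightarrow> f x > 0" "Ck_on n S f"
  shows "Ck_on n S (\<lambda>x. sqrt (f x))"
  using assms(3)
proof (induction n)
  case 0
  thus ?case by (auto intro: continuous_on_real_sqrt)
next
  case (Suc n)
  show ?case
  proof (rule Ck_on_SucI[OF assms(1)])
    fix x assume x: "x \<in> S"
    with Suc.prems have "f differentiable (at x)" by (rule Ck_on_differentiable[OF assms(1)])
    hence "(f has_derivative frechet_derivative f (at x)) (at x)"
      by (simp add: frechet_derivative_works)
    from has_derivative_real_sqrt[OF assms(2)[OF x] this]
    show "((\<lambda>x. sqrt (f x)) has_derivative
        (\<lambda>v. frechet_derivative f (at x) v * inverse (2 * sqrt (f x)))) (at x)"
      by (simp add: field_simps)
  next
    fix i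
    have "Ck_on n S (\<lambda>x. 2 * sqrt (f x))"
      using Suc Ck_on_SucD[OF Suc.prems] by (intro Ck_on_mult[OF assms(1)] Ck_on_const) auto
    hence "Ck_on n S (\<lambda>x. inverse (2 * sqrt (f x)))"
      by (intro Ck_on_inverse[OF assms(1)]) (auto dest: assms(2))
    thus "Ck_on n S (\<lambda>x. partial i f x * inverse (2 * sqrt (f x)))"
      using Suc.prems by (intro Ck_on_mult[OF assms(1)]) auto
  qed
qed

lemma Ck_on_ln:
  fixes f :: "real^2 \<Rightarrow> real"
  assumes "open S" "\<And>x. x \<in> S \<Longrightarrow> f x > 0" "Ck_on n S f"
  shows "Ck_on n S (\<lambda>x. ln (f x))"
proof (cases n)
  case 0
  thus ?thesis using assms by (auto intro!: continuous_on_ln dest: assms(2))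
next
  case (Suc m)
  show ?thesis unfolding Suc
  proof (rule Ck_on_SucI[OF assms(1)])
    fix x assume x: "x \<in> S"
    hence "f differentiable (at x)" using assms(3) Suc Ck_on_differentiable[OF assms(1)] by blast
    hence "(f has_derivative frechet_derivative f (at x)) (at x)"
      by (simp add: frechet_derivative_works)
    from has_derivative_ln[OF assms(2)[OF x] this]
    show "((\<lambda>x. ln (f x)) has_derivative
        (\<lambda>v. frechet_derivative f (at x) v * inverse (f x))) (at x)" .
  next
    fix i
    have "Ck_on m S f" using assms(3) Suc Ck_on_SucD by blast
    hence "Ck_on m S (\<lambda>x. inverse (f x))"
      by (intro Ck_on_inverse[OF assms(1)]) (auto dest: assms(2))
    thus "Ck_on m S (\<lambda>x. partial i f x * inverse (f x))"
      using assms(3) Suc by (intro Ck_on_mult[OF assms(1)]) auto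
  qed
qed

text \<open>Applying the mean value theorem first in direction \<open>i\<close> and then in direction \<open>j\<close> turns
  the second difference into a mixed derivative at a nearby point. As the second difference is symmetric
  in \<open>i\<close> and \<open>j\<close>, this yields the symmetry of second derivatives below.\<close>

lemma second_difference_mean_value:
  fixes f :: "real^2 \<Rightarrow> real"
  assumes S: "open S" "Ck_on 2 S f" and r: "ball x r \<subseteq> S" and h: "0 < h" "2 * h < r"
  shows "\<exists>y. dist x y < r \<and>
    f (x + h *\<^sub>R axis i 1 + h *\<^sub>R axis j 1) - f (x + h *\<^sub>R axis i 1) - f (x + h *\<^sub>R axis j 1) + f x
      = h\<^sup>2 * partial j (partial i f) y"
proof -
  let ?e = "\<lambda>k. axis k 1 :: real^2"
  have near: "dist x (x + s *\<^sub>R ?e i + t *\<^sub>R ?e j) < r" if "0 \<le> s" "s \<le> h" "0 \<le> t" "t \<le> h" for s t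
  proof -
    have "dist x (x + s *\<^sub>R ?e i + t *\<^sub>R ?e j) = norm (s *\<^sub>R ?e i + t *\<^sub>R ?e j)"
      by (metis add.assoc add_diff_cancel_left' dist_commute dist_norm)
    also have "\<dots> \<le> norm (s *\<^sub>R ?e i) + norm (t *\<^sub>R ?e j)" by (rule norm_triangle_ineq)
    also have "\<dots> \<le> 2 * h" using that by (simp add: norm_axis_1)
    finally show ?thesis using h by simp
  qed
  hence inS: "x + s *\<^sub>R ?e i + t *\<^sub>R ?e j \<in> S" if "0 \<le> s" "s \<le> h" "0 \<le> t" "t \<le> h" for s t
    using r that by auto
  have Ck: "Ck_on (Suc (Suc 0)) S f" "Ck_on (Suc 0) S (partial i f)"
    using S(2) by (simp_all add: numeral_2_eq_2)
  have d: "(F has_derivative frechet_derivative F (at y)) (at y)"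
    if "Ck_on (Suc n) S F" "y \<in> S" for F :: "real^2 \<Rightarrow> real" and n y
    using Ck_on_differentiable[OF S(1) that] by (simp add: frechet_derivative_works)
  have lin: "frechet_derivative F (at y) (t *\<^sub>R v) = t * frechet_derivative F (at y) v"
    if "Ck_on (Suc n) S F" "y \<in> S" for F :: "real^2 \<Rightarrow> real" and n y t v
    using has_derivative_linear[OF d[OF that]] linear_cmul by fastforce
  let ?\<phi> = "\<lambda>s. f (x + s *\<^sub>R ?e i + h *\<^sub>R ?e j) - f (x + s *\<^sub>R ?e i + 0 *\<^sub>R ?e j)"
  have "\<exists>\<xi>\<in>{0<..<h}. ?\<phi> h - ?\<phi> 0 =
      (partial i f (x + \<xi> *\<^sub>R ?e i + h *\<^sub>R ?e j) - partial i f (x + \<xi> *\<^sub>R ?e i + 0 *\<^sub>R ?e j)) * (h - 0)"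
  proof (rule mvt_simple[OF h(1)])
    fix s assume s: "0 \<le> s" "s \<le> h"
    have "((\<lambda>s. f (x + s *\<^sub>R ?e i + t *\<^sub>R ?e j)) has_derivative
        (\<lambda>v. partial i f (x + s *\<^sub>R ?e i + t *\<^sub>R ?e j) * v)) (at s within {0..h})"
      if "0 \<le> t" "t \<le> h" for t
    proof -
      have "((\<lambda>s. x + s *\<^sub>R ?e i + t *\<^sub>R ?e j) has_derivative (\<lambda>v. v *\<^sub>R ?e i)) (at s within {0..h})"
        by (auto intro!: derivative_eq_intros)
      from has_derivative_compose[OF this d[OF Ck(1) inS[OF s that]]]
      show ?thesis using lin[OF Ck(1) inS[OF s that]] by (simp add: mult.commute)
    qed
    from has_derivative_diff[OF this[of h] this[of 0]] h(1)
    have "(?\<phi> has_derivative (\<lambda>v. partial i f (x + s *\<^sub>R ?e i + h *\<^sub>R ?e j) * v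
        - partial i f (x + s *\<^sub>R ?e i + 0 *\<^sub>R ?e j) * v)) (at s within {0..h})"
      by simp
    moreover have "(\<lambda>v. a * v - b * v) = (*) (a - b)" for a b :: real
      by (simp add: fun_eq_iff left_diff_distrib)
    ultimately
    show "(?\<phi> has_derivative (*) (partial i f (x + s *\<^sub>R ?e i + h *\<^sub>R ?e j)
        - partial i f (x + s *\<^sub>R ?e i + 0 *\<^sub>R ?e j))) (at s within {0..h})"
      by metis
  qed
  then obtain \<xi> where \<xi>: "\<xi> \<in> {0<..<h}" and 1: "?\<phi> h - ?\<phi> 0 =
      (partial i f (x + \<xi> *\<^sub>R ?e i + h *\<^sub>R ?e j) - partial i f (x + \<xi> *\<^sub>R ?e i + 0 *\<^sub>R ?e j)) * (h - 0)"
    by blast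
  have "\<exists>\<eta>\<in>{0<..<h}. partial i f (x + \<xi> *\<^sub>R ?e i + h *\<^sub>R ?e j)
        - partial i f (x + \<xi> *\<^sub>R ?e i + 0 *\<^sub>R ?e j)
      = partial j (partial i f) (x + \<xi> *\<^sub>R ?e i + \<eta> *\<^sub>R ?e j) * (h - 0)"
  proof (rule mvt_simple[OF h(1)])
    fix t assume t: "0 \<le> t" "t \<le> h"
    have in': "x + \<xi> *\<^sub>R ?e i + t *\<^sub>R ?e j \<in> S" using \<xi> t by (intro inS) auto
    have "((\<lambda>t. x + \<xi> *\<^sub>R ?e i + t *\<^sub>R ?e j) has_derivative (\<lambda>v. v *\<^sub>R ?e j)) (at t within {0..h})"
      by (auto intro!: derivative_eq_intros)
    from has_derivative_compose[OF this d[OF Ck(2) in']]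
    show "((\<lambda>t. partial i f (x + \<xi> *\<^sub>R ?e i + t *\<^sub>R ?e j)) has_derivative
        (*) (partial j (partial i f) (x + \<xi> *\<^sub>R ?e i + t *\<^sub>R ?e j))) (at t within {0..h})"
      unfolding lin[OF Ck(2) in'] mult.commute[of _ "partial j _ _"] .
  qed
  then obtain \<eta> where \<eta>: "\<eta> \<in> {0<..<h}" and 2: "partial i f (x + \<xi> *\<^sub>R ?e i + h *\<^sub>R ?e j)
        - partial i f (x + \<xi> *\<^sub>R ?e i + 0 *\<^sub>R ?e j)
      = partial j (partial i f) (x + \<xi> *\<^sub>R ?e i + \<eta> *\<^sub>R ?e j) * (h - 0)"
    by blast
  have "?\<phi> h - ?\<phi> 0 = h\<^sup>2 * partial j (partial i f) (x + \<xi> *\<^sub>R ?e i + \<eta> *\<^sub>R ?e j)"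
    unfolding 1 2 by (simp add: power2_eq_square)
  moreover have "?\<phi> h - ?\<phi> 0 = f (x + h *\<^sub>R ?e i + h *\<^sub>R ?e j) - f (x + h *\<^sub>R ?e i)
      - f (x + h *\<^sub>R ?e j) + f x"
    by simp
  moreover have "dist x (x + \<xi> *\<^sub>R ?e i + \<eta> *\<^sub>R ?e j) < r" using near \<xi> \<eta> by simp
  ultimately show ?thesis by metis
qed

lemma partial_commute:
  fixes f :: "real^2 \<Rightarrow> real"
  assumes S: "open S" "Ck_on 2 S f" and x: "x \<in> S"
  shows "partial i (partial j f) x = partial j (partial i f) x"
proof -
  have cont: "isCont (partial k (partial l f)) x" for k l
    using S x by (auto simp: numeral_2_eq_2 continuous_on_eq_continuous_at)
  have "dist (partial i (partial j f) x) (partial j (partial i f) x) \<le> e" if "e > 0" for e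
  proof -
    have near: "\<exists>r>0. \<forall>y. dist y x < r \<longrightarrow>
        dist (partial k (partial l f) y) (partial k (partial l f) x) < e / 2" for k l
    proof -
      have "(partial k (partial l f) \<longlongrightarrow> partial k (partial l f) x) (nhds x)"
        using cont[where k = k and l = l]
        unfolding isCont_def tendsto_at_iff_tendsto_nhds[of "partial k (partial l f)"] .
      from tendstoD[OF this, of "e / 2"] that show ?thesis by (simp add: eventually_nhds_metric)
    qed
    from near[where k = i and l = j] near[where k = j and l = i] obtain r1 r2 where r: "r1 > 0" "r2 > 0"
      "\<And>y. dist y x < r1 \<Longrightarrow> dist (partial i (partial j f) y) (partial i (partial j f) x) < e / 2"
      "\<And>y. dist y x < r2 \<Longrightarrow> dist (partial j (partial i f) y) (partial j (partial i f) x) < e / 2"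
      by blast
    obtain r3 where r3: "r3 > 0" "ball x r3 \<subseteq> S" using S(1) x open_contains_ball by blast
    define r where "r = min r1 (min r2 r3)"
    have "r > 0" "ball x r \<subseteq> S" using r r3 by (auto simp: r_def)
    moreover from \<open>r > 0\<close> have "0 < r / 3" "2 * (r / 3) < r" by auto
    ultimately have "\<exists>y. dist x y < r \<and>
        f (x + (r/3) *\<^sub>R axis k 1 + (r/3) *\<^sub>R axis l 1) - f (x + (r/3) *\<^sub>R axis k 1)
          - f (x + (r/3) *\<^sub>R axis l 1) + f x = (r/3)\<^sup>2 * partial l (partial k f) y" for k l
      by (intro second_difference_mean_value[OF S])
    from this[of i j] this[of j i] obtain y z where yz: "dist x y < r" "dist x z < r" and
      y: "f (x + (r/3) *\<^sub>R axis i 1 + (r/3) *\<^sub>R axis j 1) - f (x + (r/3) *\<^sub>R axis i 1)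
          - f (x + (r/3) *\<^sub>R axis j 1) + f x = (r/3)\<^sup>2 * partial j (partial i f) y" and
      z: "f (x + (r/3) *\<^sub>R axis j 1 + (r/3) *\<^sub>R axis i 1) - f (x + (r/3) *\<^sub>R axis j 1)
          - f (x + (r/3) *\<^sub>R axis i 1) + f x = (r/3)\<^sup>2 * partial i (partial j f) z"
      by blast
    have comm: "x + (r/3) *\<^sub>R axis j 1 + (r/3) *\<^sub>R axis i 1
        = x + (r/3) *\<^sub>R axis i 1 + (r/3) *\<^sub>R axis j (1::real)"
      by simp
    from y z[unfolded comm] have "(r/3)\<^sup>2 * partial j (partial i f) y = (r/3)\<^sup>2 * partial i (partial j f) z"
      by linarith
    hence "partial j (partial i f) y = partial i (partial j f) z"
      using \<open>r > 0\<close> by simp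
    moreover have "dist (partial i (partial j f) z) (partial i (partial j f) x) < e / 2"
      "dist (partial j (partial i f) y) (partial j (partial i f) x) < e / 2"
      using yz r(3)[of z] r(4)[of y] by (simp_all add: r_def dist_commute[of x])
    ultimately show ?thesis unfolding dist_real_def by linarith
  qed
  hence "dist (partial i (partial j f) x) (partial j (partial i f) x) \<le> 0"
    using field_le_epsilon[of "dist (partial i (partial j f) x) (partial j (partial i f) x)" 0] by simp
  thus ?thesis by simp
qed

section \<open>Calculus in a chart\<close>

text \<open>The argument is local. Everything happens on a subset \<open>W\<close> of the domain of one chart with
  open image; \<open>W\<close> is a parameter because the inequalities live on the smaller set where a
  curvature does not vanish. From here on the plane is left behind: smooth functions on \<open>W\<close> form
  an algebra on which the coordinate derivatives \<open>D\<close> are commuting derivations.\<close>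

locale chart_patch =
  fixes c :: "'a chart" and W :: "'a set"
  assumes W_dom: "W \<subseteq> cdom c"
    and cmap_inj: "inj_on (cmap c) (cdom c)"
    and W_open: "open (cmap c ` W)"
begin

abbreviation smooth :: "('a \<Rightarrow> real) \<Rightarrow> bool" where
  "smooth \<equiv> smooth_in_chart c W"

abbreviation D :: "2 \<Rightarrow> ('a \<Rightarrow> real) \<Rightarrow> 'a \<Rightarrow> real" where
  "D \<equiv> pd c"

lemma chart_inv_cmap: "p \<in> W \<Longrightarrow> chart_inv c (cmap c p) = p"
  using W_dom cmap_inj by (auto simp: chart_inv_def intro!: inv_into_f_f)

lemma smooth_iff: "smooth f \<longleftrightarrow> smooth_on (cmap c ` W) (f \<circ> chart_inv c)"
  using W_dom by (simp add: smooth_in_chart_def Int_absorb2)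

lemma smooth_Ck: "smooth f \<Longrightarrow> Ck_on n (cmap c ` W) (\<lambda>x. f (chart_inv c x))"
  by (simp add: smooth_iff smooth_on_def comp_def)

lemma smoothI: "(\<And>n. Ck_on n (cmap c ` W) (\<lambda>x. f (chart_inv c x))) \<Longrightarrow> smooth f"
  by (simp add: smooth_iff smooth_on_def comp_def)

lemma smooth_cong:
  assumes "\<And>q. q \<in> W \<Longrightarrow> f q = f' q"
  shows "smooth f \<longleftrightarrow> smooth f'"
proof -
  have "Ck_on n (cmap c ` W) (f \<circ> chart_inv c) = Ck_on n (cmap c ` W) (f' \<circ> chart_inv c)" for n
    by (rule Ck_on_cong[OF W_open]) (auto simp: chart_inv_cmap assms)
  thus ?thesis by (simp add: smooth_iff smooth_on_def)
qed

lemma D_cong: "p \<in> W \<Longrightarrow> (\<And>q. q \<in> W \<Longrightarrow> f q = f' q) \<Longrightarrow> D i f p = D i f' p"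
  unfolding pd_def by (rule partial_cong[OF W_open]) (auto simp: chart_inv_cmap)

lemma smooth_has_derivative:
  assumes "smooth f" "p \<in> W"
  shows "((\<lambda>x. f (chart_inv c x)) has_derivative
    frechet_derivative (\<lambda>x. f (chart_inv c x)) (at (cmap c p))) (at (cmap c p))"
  using Ck_on_differentiable[OF W_open smooth_Ck[OF assms(1)]] assms(2)
  by (simp add: frechet_derivative_works)

lemma D_eqI:
  "((\<lambda>x. f (chart_inv c x)) has_derivative f') (at (cmap c p)) \<Longrightarrow> D i f p = f' (axis i 1)"
  by (simp add: pd_def comp_def partial_eqI)

lemma D_eq: "D i f p = partial i (\<lambda>x. f (chart_inv c x)) (cmap c p)"
  by (simp add: pd_def comp_def)

named_theorems smooth_intros

lemma smooth_const [smooth_intros]: "smooth (\<lambda>q. b)"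
  by (rule smoothI) (rule Ck_on_const)

lemma smooth_add [smooth_intros]: "smooth f \<Longrightarrow> smooth f' \<Longrightarrow> smooth (\<lambda>q. f q + f' q)"
  by (rule smoothI, rule Ck_on_add[OF W_open]) (rule smooth_Ck, assumption)+

lemma smooth_mult [smooth_intros]: "smooth f \<Longrightarrow> smooth f' \<Longrightarrow> smooth (\<lambda>q. f q * f' q)"
  by (rule smoothI, rule Ck_on_mult[OF W_open]) (rule smooth_Ck, assumption)+

lemma smooth_minus [smooth_intros]: "smooth f \<Longrightarrow> smooth (\<lambda>q. - f q)"
  using smooth_mult[OF smooth_const[of "-1"], of f] by simp

lemma smooth_diff [smooth_intros]: "smooth f \<Longrightarrow> smooth f' \<Longrightarrow> smooth (\<lambda>q. f q - f' q)"
  using smooth_add[of f "\<lambda>q. - f' q"] smooth_minus[of f'] by simp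

lemma smooth_inverse [smooth_intros]:
  "smooth f \<Longrightarrow> (\<And>q. q \<in> W \<Longrightarrow> f q \<noteq> 0) \<Longrightarrow> smooth (\<lambda>q. inverse (f q))"
  by (rule smoothI, rule Ck_on_inverse[OF W_open]) (auto simp: chart_inv_cmap smooth_Ck)

lemma smooth_divide [smooth_intros]:
  "smooth f \<Longrightarrow> smooth f' \<Longrightarrow> (\<And>q. q \<in> W \<Longrightarrow> f' q \<noteq> 0) \<Longrightarrow> smooth (\<lambda>q. f q / f' q)"
  unfolding divide_inverse by (intro smooth_mult smooth_inverse)

lemma smooth_power [smooth_intros]: "smooth f \<Longrightarrow> smooth (\<lambda>q. f q ^ n)"
  by (induction n) (simp_all add: smooth_const smooth_mult)

lemma smooth_sqrt [smooth_intros]: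
  "smooth f \<Longrightarrow> (\<And>q. q \<in> W \<Longrightarrow> f q > 0) \<Longrightarrow> smooth (\<lambda>q. sqrt (f q))"
  by (rule smoothI, rule Ck_on_sqrt[OF W_open]) (auto simp: chart_inv_cmap smooth_Ck)

lemma smooth_ln [smooth_intros]:
  "smooth f \<Longrightarrow> (\<And>q. q \<in> W \<Longrightarrow> f q > 0) \<Longrightarrow> smooth (\<lambda>q. ln (f q))"
  by (rule smoothI, rule Ck_on_ln[OF W_open]) (auto simp: chart_inv_cmap smooth_Ck)

lemma smooth_D [smooth_intros]: "smooth f \<Longrightarrow> smooth (D i f)"
proof (rule smoothI)
  fix n assume "smooth f"
  from smooth_Ck[OF this, of "Suc n"]
  have "Ck_on n (cmap c ` W) (partial i (\<lambda>x. f (chart_inv c x)))" by simp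
  thus "Ck_on n (cmap c ` W) (\<lambda>x. D i f (chart_inv c x))"
    by (rule Ck_on_cong[OF W_open, THEN iffD1, rotated]) (auto simp: D_eq chart_inv_cmap)
qed

lemma D_add:
  assumes "smooth f" "smooth f'" "p \<in> W"
  shows "D i (\<lambda>q. f q + f' q) p = D i f p + D i f' p"
  using D_eqI[OF has_derivative_add[OF smooth_has_derivative[OF assms(1,3)] smooth_has_derivative[OF assms(2,3)]]]
  by (simp add: D_eq)

lemma D_mult:
  assumes "smooth f" "smooth f'" "p \<in> W"
  shows "D i (\<lambda>q. f q * f' q) p = f p * D i f' p + D i f p * f' p"
  using D_eqI[OF has_derivative_mult[OF smooth_has_derivative[OF assms(1,3)] smooth_has_derivative[OF assms(2,3)]]] assms(3)
  by (simp add: D_eq chart_inv_cmap)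

lemma D_minus:
  assumes "smooth f" "p \<in> W"
  shows "D i (\<lambda>q. - f q) p = - D i f p"
  using D_eqI[OF has_derivative_minus[OF smooth_has_derivative[OF assms]]] by (simp add: D_eq)

lemma D_diff:
  assumes "smooth f" "smooth f'" "p \<in> W"
  shows "D i (\<lambda>q. f q - f' q) p = D i f p - D i f' p"
  using D_eqI[OF has_derivative_diff[OF smooth_has_derivative[OF assms(1,3)] smooth_has_derivative[OF assms(2,3)]]]
  by (simp add: D_eq)

lemma D_compose:
  assumes "smooth f" "p \<in> W" "(F has_real_derivative F') (at (f p))"
  shows "D i (\<lambda>q. F (f q)) p = F' * D i f p"
proof -
  have "((\<lambda>x. F (f (chart_inv c x))) has_derivative
      (\<lambda>v. F' * frechet_derivative (\<lambda>x. f (chart_inv c x)) (at (cmap c p)) v)) (at (cmap c p))"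
    using has_derivative_compose[OF smooth_has_derivative[OF assms(1,2)], of F "(*) F'"] assms(2,3)
    by (simp add: chart_inv_cmap has_field_derivative_def)
  from D_eqI[OF this] show ?thesis by (simp add: D_eq)
qed

lemma D_commute:
  assumes "smooth f" "p \<in> W"
  shows "D i (D j f) p = D j (D i f) p"
proof -
  have "D k (D l f) p = partial k (partial l (\<lambda>x. f (chart_inv c x))) (cmap c p)" for k l
    unfolding D_eq[of k]
    by (rule partial_cong[OF W_open]) (use assms in \<open>auto simp: D_eq chart_inv_cmap\<close>)
  thus ?thesis
    using partial_commute[OF W_open smooth_Ck[OF assms(1)]] assms(2) by simp
qed

definition along :: "('a \<Rightarrow> real^2) \<Rightarrow> ('a \<Rightarrow> real) \<Rightarrow> 'a \<Rightarrow> real" where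
  "along Z f q = Z q $ 1 * D 1 f q + Z q $ 2 * D 2 f q"

lemma along_cong: "p \<in> W \<Longrightarrow> (\<And>q. q \<in> W \<Longrightarrow> f q = f' q) \<Longrightarrow> along Z f p = along Z f' p"
  using D_cong[of p f f'] by (simp add: along_def)

lemma along_add:
  "smooth f \<Longrightarrow> smooth f' \<Longrightarrow> p \<in> W \<Longrightarrow> along Z (\<lambda>q. f q + f' q) p = along Z f p + along Z f' p"
  by (simp add: along_def D_add algebra_simps)

lemma along_minus: "smooth f \<Longrightarrow> p \<in> W \<Longrightarrow> along Z (\<lambda>q. - f q) p = - along Z f p"
  by (simp add: along_def D_minus algebra_simps)

lemma along_mult:
  "smooth f \<Longrightarrow> smooth f' \<Longrightarrow> p \<in> W \<Longrightarrow>
    along Z (\<lambda>q. f q * f' q) p = f p * along Z f' p + along Z f p * f' p"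
  by (simp add: along_def D_mult algebra_simps)

lemma along_compose:
  "smooth f \<Longrightarrow> p \<in> W \<Longrightarrow> (F has_real_derivative F') (at (f p)) \<Longrightarrow>
    along Z (\<lambda>q. F (f q)) p = F' * along Z f p"
  by (simp add: along_def D_compose algebra_simps)

lemma smooth_along:
  assumes "\<And>i. smooth (\<lambda>q. Z q $ i)" "smooth f"
  shows "smooth (along Z f)"
proof -
  have "smooth (\<lambda>q. along Z f q)"
    unfolding along_def by (intro smooth_add smooth_mult assms smooth_D)
  thus ?thesis .
qed

lemma smooth_ln_abs:
  assumes "smooth f" "\<And>q. q \<in> W \<Longrightarrow> f q \<noteq> 0"
  shows "smooth (\<lambda>q. ln \<bar>f q\<bar>)"
proof -
  \<comment> \<open>The absolute value is written as a smooth function of \<open>f\<close>.\<close>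
  have "smooth (\<lambda>q. ln (sqrt ((f q)\<^sup>2)))"
    by (intro smooth_ln smooth_sqrt smooth_power assms(1)) (simp_all add: assms(2))
  thus ?thesis by simp
qed

lemma along_ln_abs:
  assumes "smooth f" "p \<in> W" "f p \<noteq> 0"
  shows "along Z (\<lambda>q. ln \<bar>f q\<bar>) p = along Z f p / f p"
proof -
  have "((\<lambda>x. ln \<bar>x\<bar>) has_real_derivative 1 / f p) (at (f p))"
  proof (cases "f p > 0")
    case True
    show ?thesis
      by (rule has_field_derivative_transform_within_open[OF DERIV_ln_divide[OF True], of "{0<..}"])
        (use True in auto)
  next
    case False
    hence "((\<lambda>x. ln (- x)) has_real_derivative 1 / f p) (at (f p))"
      using assms(3) by (auto intro!: derivative_eq_intros)
    thus ?thesis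
      by (rule has_field_derivative_transform_within_open[of _ _ _ "{..<0}"])
        (use False assms(3) in auto)
  qed
  from along_compose[OF assms(1,2) this] show ?thesis by simp
qed

lemma open_nonzero:
  assumes "smooth f"
  shows "open (cmap c ` {q \<in> W. f q \<noteq> 0})"
proof -
  have "continuous_on (cmap c ` W) (\<lambda>x. f (chart_inv c x))"
    using smooth_Ck[OF assms, of 0] by simp
  from continuous_open_preimage[OF this W_open, of "- {0}"]
  have "open (cmap c ` W \<inter> (\<lambda>x. f (chart_inv c x)) -` (- {0}))" by (simp add: open_Compl)
  also have "cmap c ` W \<inter> (\<lambda>x. f (chart_inv c x)) -` (- {0}) = cmap c ` {q \<in> W. f q \<noteq> 0}"
    by (auto simp: chart_inv_cmap)
  finally show ?thesis .
qed

end

section \<open>Metric, gradient and divergence in a chart\<close>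

locale metric_patch = chart_patch c W for c :: "'a chart" and W :: "'a set" +
  fixes g :: "'a chart \<Rightarrow> 'a \<Rightarrow> real^2^2"
  assumes g_smooth: "smooth_in_chart c W (\<lambda>q. g c q $ i $ j)"
    and g_sym: "p \<in> W \<Longrightarrow> g c p $ i $ j = g c p $ j $ i"
    and g_pos: "p \<in> W \<Longrightarrow> X \<noteq> 0 \<Longrightarrow> X \<bullet> (g c p *v X) > 0"

lemma matrix_inv_2:
  fixes B :: "real^2^2"
  assumes "det B \<noteq> 0"
  shows "matrix_inv B $ 1 $ 1 = B $ 2 $ 2 / det B" "matrix_inv B $ 1 $ 2 = - B $ 1 $ 2 / det B"
    "matrix_inv B $ 2 $ 1 = - B $ 2 $ 1 / det B" "matrix_inv B $ 2 $ 2 = B $ 1 $ 1 / det B"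
proof -
  let ?C = "(1 / det B) *\<^sub>R (vector [vector [B $ 2 $ 2, - B $ 1 $ 2],
    vector [- B $ 2 $ 1, B $ 1 $ 1]] :: real^2^2)"
  have "B $ 1 $ 1 * B $ 2 $ 2 = det B + B $ 1 $ 2 * B $ 2 $ 1" by (simp add: det_2)
  hence "B ** ?C = mat 1"
    using assms
    by (simp add: vec_eq_iff forall_2 matrix_matrix_mult_def sum_2 mat_def field_simps)
  hence "matrix_inv B ** B ** ?C = matrix_inv B ** mat 1" by (simp flip: matrix_mul_assoc)
  moreover have "matrix_inv B ** B = mat 1"
    using assms unfolding invertible_det_nz[symmetric] invertible_def matrix_inv_def
    by (rule someI2_ex) simp
  ultimately have C: "matrix_inv B = ?C" by simp
  show "matrix_inv B $ 1 $ 1 = B $ 2 $ 2 / det B" "matrix_inv B $ 1 $ 2 = - B $ 1 $ 2 / det B"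
    "matrix_inv B $ 2 $ 1 = - B $ 2 $ 1 / det B" "matrix_inv B $ 2 $ 2 = B $ 1 $ 1 / det B"
    unfolding C by simp_all
qed

context metric_patch begin

abbreviation G :: "2 \<Rightarrow> 2 \<Rightarrow> 'a \<Rightarrow> real" where "G i j q \<equiv> g c q $ i $ j"

lemma ginner_expand:
  "ginner g c p X Y = G 1 1 p * X $ 1 * Y $ 1 + G 1 2 p * X $ 1 * Y $ 2
     + G 2 1 p * X $ 2 * Y $ 1 + G 2 2 p * X $ 2 * Y $ 2"
  by (simp add: ginner_def inner_vec_def matrix_vector_mult_def sum_2 algebra_simps)

lemma det_g_pos:
  assumes "p \<in> W"
  shows "det (g c p) > 0"
proof -
  have E: "G 1 1 p > 0"
    using g_pos[OF assms, of "vector [1, 0]"]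
    by (simp add: ginner_def[symmetric] ginner_expand vec_eq_iff forall_2)
  have "G 1 1 p * det (g c p) > 0"
    \<comment> \<open>This vector is orthogonal to the first coordinate vector; its squared length is the left side.\<close>
    using g_pos[OF assms, of "vector [- G 1 2 p, G 1 1 p]"] E g_sym[OF assms, of 2 1]
    by (simp add: ginner_def[symmetric] ginner_expand vec_eq_iff forall_2 det_2 algebra_simps)
  with E show ?thesis by (simp add: zero_less_mult_iff)
qed

lemma vol_pos: "p \<in> W \<Longrightarrow> vol g c p > 0"
  by (simp add: vol_def det_g_pos)

lemma vol_sq: "p \<in> W \<Longrightarrow> (vol g c p)\<^sup>2 = G 1 1 p * G 2 2 p - (G 1 2 p)\<^sup>2"
  using det_g_pos[of p] g_sym[of p 2 1] by (simp add: vol_def det_2 power2_eq_square)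

lemma smooth_det [smooth_intros]: "smooth (\<lambda>q. det (g c q))"
  unfolding det_2 by (intro smooth_intros g_smooth)

lemma smooth_vol [smooth_intros]: "smooth (vol g c)"
  unfolding vol_def by (intro smooth_intros det_g_pos)

lemma smooth_ginv: "smooth (\<lambda>q. matrix_inv (g c q) $ i $ j)"
proof -
  have nz: "det (g c q) \<noteq> 0" if "q \<in> W" for q using det_g_pos[OF that] by simp
  have 1: "smooth (\<lambda>q. G a b q / det (g c q))" for a b
    by (rule smooth_divide[OF g_smooth smooth_det nz])
  have 2: "smooth (\<lambda>q. - G a b q / det (g c q))" for a b
    by (rule smooth_divide[OF smooth_minus[OF g_smooth] smooth_det nz])
  note cong = smooth_cong[OF matrix_inv_2(1)[OF nz]] smooth_cong[OF matrix_inv_2(2)[OF nz]]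
    smooth_cong[OF matrix_inv_2(3)[OF nz]] smooth_cong[OF matrix_inv_2(4)[OF nz]]
  show ?thesis
    using exhaust_2[of i] exhaust_2[of j] 1 2 by (elim disjE) (simp_all add: cong)
qed

lemma grad_nth: "grad g c f q $ i
    = matrix_inv (g c q) $ i $ 1 * D 1 f q + matrix_inv (g c q) $ i $ 2 * D 2 f q"
  by (simp add: grad_def matrix_vector_mult_def sum_2)

lemma smooth_grad [smooth_intros]: "smooth f \<Longrightarrow> smooth (\<lambda>q. grad g c f q $ i)"
  unfolding grad_nth by (intro smooth_intros smooth_ginv)

text \<open>\<open>g\<close> times its inverse is the identity, applied to a covector \<open>v\<close>.\<close>

lemma g_ginv_apply:
  fixes v :: "2 \<Rightarrow> real"
  assumes "p \<in> W"
  shows "G i 1 p * (matrix_inv (g c p) $ 1 $ 1 * v 1 + matrix_inv (g c p) $ 1 $ 2 * v 2)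
    + G i 2 p * (matrix_inv (g c p) $ 2 $ 1 * v 1 + matrix_inv (g c p) $ 2 $ 2 * v 2) = v i"
proof -
  have nz: "det (g c p) \<noteq> 0" using det_g_pos[OF assms] by simp
  have d: "G 1 1 p * G 2 2 p = det (g c p) + G 1 2 p * G 2 1 p" by (simp add: det_2)
  consider "i = 1" | "i = 2" using exhaust_2 by blast
  thus ?thesis
    by cases (use nz d in \<open>simp_all add: matrix_inv_2[OF nz] field_simps\<close>)
qed

lemma D_eq_g_grad:
  "p \<in> W \<Longrightarrow> D i f p = G i 1 p * grad g c f p $ 1 + G i 2 p * grad g c f p $ 2"
  using g_ginv_apply[of p i "\<lambda>i. D i f p"] by (simp add: grad_nth)

lemma ginner_scaleR: "ginner g c p Z (r *\<^sub>R Z') = r * ginner g c p Z Z'"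
  by (simp add: ginner_expand algebra_simps)

lemma ginner_grad:
  assumes "p \<in> W"
  shows "ginner g c p (grad g c f p) (Z p) = along Z f p"
  by (simp add: along_def ginner_expand D_eq_g_grad[OF assms, of _ f] g_sym[OF assms, of 2 1]
      algebra_simps)

text \<open>Avoids the inverse metric: a gradient is recognized by lowering its index.\<close>

lemma grad_unique:
  assumes "p \<in> W" "\<And>i. G i 1 p * Z $ 1 + G i 2 p * Z $ 2 = D i f p"
  shows "grad g c f p = Z"
proof -
  let ?X = "grad g c f p"
  have nz: "G 1 1 p * G 2 2 p - G 1 2 p * G 2 1 p \<noteq> 0"
    using det_g_pos[OF assms(1)] by (simp add: det_2)
  have eq: "G i 1 p * ?X $ 1 + G i 2 p * ?X $ 2 = G i 1 p * Z $ 1 + G i 2 p * Z $ 2" for i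
    using D_eq_g_grad[OF assms(1), of i f] assms(2)[of i] by simp
  have "(G 1 1 p * G 2 2 p - G 1 2 p * G 2 1 p) * ?X $ 1
      = (G 1 1 p * G 2 2 p - G 1 2 p * G 2 1 p) * Z $ 1"
    "(G 1 1 p * G 2 2 p - G 1 2 p * G 2 1 p) * ?X $ 2
      = (G 1 1 p * G 2 2 p - G 1 2 p * G 2 1 p) * Z $ 2"
    using eq[of 1] eq[of 2] by algebra+
  with nz show ?thesis by (simp add: vec_eq_iff forall_2)
qed

lemma grad_cong:
  assumes "p \<in> W" "\<And>q. q \<in> W \<Longrightarrow> f q = f' q"
  shows "grad g c f p = grad g c f' p"
  using D_cong[OF assms] by (simp add: grad_def)

lemma divergence_cong:
  assumes "p \<in> W" "\<And>q. q \<in> W \<Longrightarrow> X q = Y q"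
  shows "divergence g c X p = divergence g c Y p"
proof -
  have "D i (\<lambda>q. vol g c q * X q $ i) p = D i (\<lambda>q. vol g c q * Y q $ i) p" for i
    by (rule D_cong[OF assms(1)]) (simp add: assms(2))
  thus ?thesis by (simp add: divergence_def)
qed

lemma laplacian_cong:
  assumes "p \<in> W" "\<And>q. q \<in> W \<Longrightarrow> f q = f' q"
  shows "laplacian g c f p = laplacian g c f' p"
  unfolding laplacian_def by (rule divergence_cong[OF assms(1)]) (rule grad_cong, auto simp: assms)

lemma divergence_add:
  assumes "p \<in> W" "\<And>i. smooth (\<lambda>q. X q $ i)" "\<And>i. smooth (\<lambda>q. Y q $ i)"
  shows "divergence g c (\<lambda>q. X q + Y q) p = divergence g c X p + divergence g c Y p"
  using assms
  by (simp add: divergence_def sum_2 ring_distribs D_add smooth_intros add_divide_distrib)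

lemma divergence_scaleR:
  assumes "p \<in> W" "smooth f" "\<And>i. smooth (\<lambda>q. X q $ i)"
  shows "divergence g c (\<lambda>q. f q *\<^sub>R X q) p
    = f p * divergence g c X p + along X f p"
proof -
  have "D i (\<lambda>q. vol g c q * (f q * X q $ i)) p
      = f p * D i (\<lambda>q. vol g c q * X q $ i) p + D i f p * (vol g c p * X p $ i)" for i
  proof -
    have "D i (\<lambda>q. vol g c q * (f q * X q $ i)) p = D i (\<lambda>q. f q * (vol g c q * X q $ i)) p"
      by (simp add: mult.left_commute)
    thus ?thesis using assms by (simp add: D_mult smooth_intros)
  qed
  thus ?thesis using vol_pos[OF assms(1)]
    by (simp add: divergence_def along_def sum_2 field_simps)
qed

text \<open>\<open>\<star>\<nabla>f\<close> is the field whose flux form is \<open>df\<close> itself.\<close>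

lemma vol_hodge_grad:
  assumes "p \<in> W"
  shows "vol g c p * hodge g c p (grad g c f p) $ 1 = - D 2 f p"
    "vol g c p * hodge g c p (grad g c f p) $ 2 = D 1 f p"
  using vol_pos[OF assms] g_sym[OF assms, of 2 1]
  by (simp_all add: hodge_def D_eq_g_grad[OF assms, of _ f])

lemma smooth_hodge_grad:
  assumes "smooth f"
  shows "smooth (\<lambda>q. hodge g c q (grad g c f q) $ i)"
proof -
  have nz: "vol g c q \<noteq> 0" if "q \<in> W" for q using vol_pos[OF that] by simp
  have "smooth (\<lambda>q. - D 2 f q / vol g c q)"
    by (rule smooth_divide[OF smooth_minus[OF smooth_D[OF assms]] smooth_vol nz])
  moreover have "smooth (\<lambda>q. D 1 f q / vol g c q)"
    by (rule smooth_divide[OF smooth_D[OF assms] smooth_vol nz])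
  moreover have "hodge g c q (grad g c f q) $ 1 = - D 2 f q / vol g c q"
    "hodge g c q (grad g c f q) $ 2 = D 1 f q / vol g c q" if "q \<in> W" for q
    using vol_hodge_grad[OF that, of f] nz[OF that] by (auto simp: field_simps)
  note cong = smooth_cong[OF this(1)] smooth_cong[OF this(2)]
  ultimately show ?thesis
    using exhaust_2[of i] by (elim disjE) (simp_all add: cong)
qed

lemma divergence_hodge_grad:
  assumes "p \<in> W" "smooth f"
  shows "divergence g c (\<lambda>q. hodge g c q (grad g c f q)) p = 0"
proof -
  have "D 1 (\<lambda>q. vol g c q * hodge g c q (grad g c f q) $ 1) p = D 1 (\<lambda>q. - D 2 f q) p"
    "D 2 (\<lambda>q. vol g c q * hodge g c q (grad g c f q) $ 2) p = D 2 (D 1 f) p"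
    using vol_hodge_grad by (auto intro!: D_cong[OF assms(1)])
  thus ?thesis
    using assms D_commute[of f p 1 2] by (simp add: divergence_def sum_2 D_minus smooth_intros)
qed

end

section \<open>Curvature from an orthonormal coframe\<close>

context metric_patch begin

lemma g_christoffel:
  assumes "p \<in> W"
  shows "G m 1 p * christoffel g c 1 i j p + G m 2 p * christoffel g c 2 i j p
    = (D i (G j m) p + D j (G i m) p - D m (G i j) p) / 2"
  using g_ginv_apply[OF assms, of m "\<lambda>l. (D i (G j l) p + D j (G i l) p - D l (G i j) p) / 2"]
  by (simp add: christoffel_def sum_2 add_divide_distrib)

lemma smooth_christoffel [smooth_intros]: "smooth (christoffel g c k i j)"
proof -
  have "smooth (\<lambda>q. christoffel g c k i j q)"
    unfolding christoffel_def sum_2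
    by (intro smooth_divide smooth_add smooth_mult smooth_diff smooth_const smooth_ginv smooth_D
        g_smooth) simp
  thus ?thesis .
qed

text \<open>The Levi-Civita connection is the only torsion-free metric connection, so its symbols
  can be read off from any candidate that is symmetric and metric. Given an orthonormal coframe
  \<open>a, b\<close> and a form \<open>\<omega>\<close> with \<open>da = - \<omega> \<and> b\<close> and \<open>db = \<omega> \<and> a\<close>, the candidate is the
  connection whose connection form in the frame is \<open>\<omega>\<close>: the structure equations
  say that it is symmetric, and it is metric because \<open>\<omega>\<close> acts by an infinitesimal rotation.\<close>

lemma coframe_christoffel:
  fixes a b \<omega> :: "2 \<Rightarrow> 'a \<Rightarrow> real"
  assumes smooth: "\<And>i. smooth (a i)" "\<And>i. smooth (b i)"
    and metric: "\<And>i j q. q \<in> W \<Longrightarrow> G i j q = a i q * a j q + b i q * b j q"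
    and da: "\<And>q. q \<in> W \<Longrightarrow> D 1 (a 2) q - D 2 (a 1) q = \<omega> 2 q * b 1 q - \<omega> 1 q * b 2 q"
    and db: "\<And>q. q \<in> W \<Longrightarrow> D 1 (b 2) q - D 2 (b 1) q = \<omega> 1 q * a 2 q - \<omega> 2 q * a 1 q"
    and p: "p \<in> W"
  shows "a 1 p * christoffel g c 1 i j p + a 2 p * christoffel g c 2 i j p
      = D i (a j) p + \<omega> i p * b j p" (is "?\<alpha> = ?\<alpha>'")
    and "b 1 p * christoffel g c 1 i j p + b 2 p * christoffel g c 2 i j p
      = D i (b j) p - \<omega> i p * a j p" (is "?\<beta> = ?\<beta>'")
proof -
  have dG: "D l (G k m) p = a k p * D l (a m) p + D l (a k) p * a m p
      + (b k p * D l (b m) p + D l (b k) p * b m p)" for l k m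
  proof -
    have "D l (G k m) p = D l (\<lambda>q. a k q * a m q + b k q * b m q) p"
      by (rule D_cong[OF p]) (simp add: metric)
    thus ?thesis using p smooth by (simp add: D_add D_mult smooth_mult)
  qed
  have da': "D k (a l) p - D l (a k) p = \<omega> l p * b k p - \<omega> k p * b l p" for k l
    using da[OF p] exhaust_2[of k] exhaust_2[of l] by auto
  have db': "D k (b l) p - D l (b k) p = \<omega> k p * a l p - \<omega> l p * a k p" for k l
    using db[OF p] exhaust_2[of k] exhaust_2[of l] by auto
  have "a m p * ?\<alpha> + b m p * ?\<beta> = a m p * ?\<alpha>' + b m p * ?\<beta>'" for m
  proof -
    have a: "D j (a i) p = D i (a j) p - (\<omega> j p * b i p - \<omega> i p * b j p)"
      "D m (a i) p = D i (a m) p - (\<omega> m p * b i p - \<omega> i p * b m p)"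
      "D m (a j) p = D j (a m) p - (\<omega> m p * b j p - \<omega> j p * b m p)"
      using da' by (simp_all add: algebra_simps)
    have b: "D j (b i) p = D i (b j) p - (\<omega> i p * a j p - \<omega> j p * a i p)"
      "D m (b i) p = D i (b m) p - (\<omega> i p * a m p - \<omega> m p * a i p)"
      "D m (b j) p = D j (b m) p - (\<omega> j p * a m p - \<omega> m p * a j p)"
      using db' by (simp_all add: algebra_simps)
    have "a m p * ?\<alpha> + b m p * ?\<beta>
        = G m 1 p * christoffel g c 1 i j p + G m 2 p * christoffel g c 2 i j p"
      by (simp add: metric[OF p] algebra_simps)
    also have "\<dots> = a m p * ?\<alpha>' + b m p * ?\<beta>'"
      unfolding g_christoffel[OF p] dG a b by (simp add: field_simps)
    finally show ?thesis .
  qed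
  note eq = this[of 1] this[of 2]
  \<comment> \<open>The coframe is linearly independent, so these two equations determine both unknowns.\<close>
  have "det (g c p) = (a 1 p * b 2 p - a 2 p * b 1 p)\<^sup>2"
    by (simp add: det_2 metric[OF p] power2_eq_square algebra_simps)
  hence nz: "a 1 p * b 2 p - a 2 p * b 1 p \<noteq> 0"
    using det_g_pos[OF p] by auto
  have "(a 1 p * b 2 p - a 2 p * b 1 p) * ?\<alpha> = (a 1 p * b 2 p - a 2 p * b 1 p) * ?\<alpha>'"
    using eq by algebra
  with nz show "?\<alpha> = ?\<alpha>'" by simp
  have "(a 1 p * b 2 p - a 2 p * b 1 p) * ?\<beta> = (a 1 p * b 2 p - a 2 p * b 1 p) * ?\<beta>'"
    using eq by algebra
  with nz show "?\<beta> = ?\<beta>'" by simp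
qed

text \<open>Cartan's second structure equation \<open>K * area form = d\<omega>\<close>. Differentiating the
  identities \<open>a(\<Gamma>) = \<partial>a + \<omega> b\<close> and \<open>b(\<Gamma>) = \<partial>b - \<omega> a\<close> and antisymmetrizing cancels all
  second derivatives of the coframe and all products of Christoffel symbols; only \<open>d\<omega>\<close> survives.\<close>

theorem gauss_curvature_coframe:
  fixes a b \<omega> :: "2 \<Rightarrow> 'a \<Rightarrow> real"
  assumes smooth: "\<And>i. smooth (a i)" "\<And>i. smooth (b i)" "\<And>i. smooth (\<omega> i)"
    and metric: "\<And>i j q. q \<in> W \<Longrightarrow> G i j q = a i q * a j q + b i q * b j q"
    and da: "\<And>q. q \<in> W \<Longrightarrow> D 1 (a 2) q - D 2 (a 1) q = \<omega> 2 q * b 1 q - \<omega> 1 q * b 2 q"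
    and db: "\<And>q. q \<in> W \<Longrightarrow> D 1 (b 2) q - D 2 (b 1) q = \<omega> 1 q * a 2 q - \<omega> 2 q * a 1 q"
    and p: "p \<in> W"
  shows "gauss_curvature g c p * (a 1 p * b 2 p - a 2 p * b 1 p) = D 1 (\<omega> 2) p - D 2 (\<omega> 1) p"
proof -
  let ?\<Gamma> = "christoffel g c"
  have \<Gamma>a: "a 1 q * ?\<Gamma> 1 i j q + a 2 q * ?\<Gamma> 2 i j q = D i (a j) q + \<omega> i q * b j q"
    and \<Gamma>b: "b 1 q * ?\<Gamma> 1 i j q + b 2 q * ?\<Gamma> 2 i j q = D i (b j) q - \<omega> i q * a j q"
    if "q \<in> W" for i j q
    using coframe_christoffel[of a b \<omega>, OF smooth(1,2) metric da db that] by blast+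
  have Da: "D k (D i (a j)) p + (\<omega> i p * D k (b j) p + D k (\<omega> i) p * b j p)
      = a 1 p * D k (?\<Gamma> 1 i j) p + D k (a 1) p * ?\<Gamma> 1 i j p
        + (a 2 p * D k (?\<Gamma> 2 i j) p + D k (a 2) p * ?\<Gamma> 2 i j p)" for i j k
  proof -
    have "D k (\<lambda>q. a 1 q * ?\<Gamma> 1 i j q + a 2 q * ?\<Gamma> 2 i j q) p
        = D k (\<lambda>q. D i (a j) q + \<omega> i q * b j q) p"
      by (rule D_cong[OF p]) (rule \<Gamma>a)
    thus ?thesis
      using p smooth by (simp add: D_add D_mult smooth_mult smooth_D smooth_christoffel)
  qed
  have Db: "D k (D i (b j)) p - (\<omega> i p * D k (a j) p + D k (\<omega> i) p * a j p)
      = b 1 p * D k (?\<Gamma> 1 i j) p + D k (b 1) p * ?\<Gamma> 1 i j p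
        + (b 2 p * D k (?\<Gamma> 2 i j) p + D k (b 2) p * ?\<Gamma> 2 i j p)" for i j k
  proof -
    have "D k (\<lambda>q. b 1 q * ?\<Gamma> 1 i j q + b 2 q * ?\<Gamma> 2 i j q) p
        = D k (\<lambda>q. D i (b j) q - \<omega> i q * a j q) p"
      by (rule D_cong[OF p]) (rule \<Gamma>b)
    thus ?thesis
      using p smooth by (simp add: D_add D_diff D_mult smooth_mult smooth_D smooth_christoffel)
  qed
  let ?d\<omega> = "D 1 (\<omega> 2) p - D 2 (\<omega> 1) p" and ?R = "\<lambda>l. riemann g c l 2 1 2 p"
  have aR: "a 1 p * ?R 1 + a 2 p * ?R 2 = ?d\<omega> * b 2 p"
    using Da[of 1 2 2] Da[of 2 1 2] \<Gamma>a[OF p, of 1 1] \<Gamma>a[OF p, of 1 2] \<Gamma>a[OF p, of 2 1]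
      \<Gamma>a[OF p, of 2 2] \<Gamma>b[OF p, of 1 2] \<Gamma>b[OF p, of 2 2] D_commute[OF smooth(1) p, of 1 2 2]
    unfolding riemann_def sum_2 by algebra
  have bR: "b 1 p * ?R 1 + b 2 p * ?R 2 = - ?d\<omega> * a 2 p"
    using Db[of 1 2 2] Db[of 2 1 2] \<Gamma>b[OF p, of 1 1] \<Gamma>b[OF p, of 1 2] \<Gamma>b[OF p, of 2 1]
      \<Gamma>b[OF p, of 2 2] \<Gamma>a[OF p, of 1 2] \<Gamma>a[OF p, of 2 2] D_commute[OF smooth(2) p, of 1 2 2]
    unfolding riemann_def sum_2 by algebra
  have det: "det (g c p) = (a 1 p * b 2 p - a 2 p * b 1 p)\<^sup>2"
    by (simp add: det_2 metric[OF p] power2_eq_square algebra_simps)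
  have "gauss_curvature g c p * det (g c p)
      = a 1 p * (a 1 p * ?R 1 + a 2 p * ?R 2) + b 1 p * (b 1 p * ?R 1 + b 2 p * ?R 2)"
  proof -
    have "gauss_curvature g c p * det (g c p) = G 1 1 p * ?R 1 + G 1 2 p * ?R 2"
      using det_g_pos[OF p] by (simp add: gauss_curvature_def sum_2)
    thus ?thesis by (simp add: metric[OF p] algebra_simps)
  qed
  also have "\<dots> = ?d\<omega> * (a 1 p * b 2 p - a 2 p * b 1 p)"
    unfolding aR bR by (simp add: algebra_simps)
  finally have "(gauss_curvature g c p * (a 1 p * b 2 p - a 2 p * b 1 p) - ?d\<omega>)
      * (a 1 p * b 2 p - a 2 p * b 1 p) = 0"
    unfolding det by (simp add: power2_eq_square algebra_simps)
  thus ?thesis using det_g_pos[OF p] unfolding det by auto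
qed

end

section \<open>Harmonic functions without critical points\<close>

locale harmonic_patch = metric_patch c W g
  for c :: "'a chart" and W :: "'a set" and g :: "'a chart \<Rightarrow> 'a \<Rightarrow> real^2^2" +
  fixes u :: "'a \<Rightarrow> real"
  assumes u_smooth: "smooth_in_chart c W u"
    and u_harmonic: "p \<in> W \<Longrightarrow> laplacian g c u p = 0"
    and u_noncritical: "p \<in> W \<Longrightarrow> \<exists>i. pd c i u p \<noteq> 0"
begin

abbreviation X :: "'a \<Rightarrow> real^2" where "X \<equiv> grad g c u"
abbreviation Y :: "'a \<Rightarrow> real^2" where "Y \<equiv> (\<lambda>q. hodge g c q (grad g c u q))"
abbreviation m :: "'a \<Rightarrow> real" where "m \<equiv> vol g c"

definition N :: "'a \<Rightarrow> real" where "N q = gnorm g c q (X q)"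

definition logN :: "'a \<Rightarrow> real" where "logN q = ln (N q)"

text \<open>The functions \<open>v i\<close> are the components of the 1-form \<open>\<star>du\<close>. It is closed
  because \<open>u\<close> is harmonic, so it behaves like the differential of a harmonic conjugate, and
  \<open>du, v\<close> behave like the differentials of isothermal coordinates. The fields \<open>U = \<nabla>u / |\<nabla>u|\<^sup>2\<close> and
  \<open>V = \<star>\<nabla>u / |\<nabla>u|\<^sup>2\<close> are the dual coordinate fields. Working with the closed form and the fields
  avoids constructing the conjugate function and changing coordinates.\<close>

definition v :: "2 \<Rightarrow> 'a \<Rightarrow> real" where
  "v i q = (if i = 1 then - (m q * X q $ 2) else m q * X q $ 1)"

definition U where "U q = (1 / (N q)\<^sup>2) *\<^sub>R X q"
definition V where "V q = (1 / (N q)\<^sup>2) *\<^sub>R Y q"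

lemma v_simps: "v 1 q = - (m q * X q $ 2)" "v 2 q = m q * X q $ 1"
  by (simp_all add: v_def)

lemma du: "p \<in> W \<Longrightarrow> D i u p = G i 1 p * X p $ 1 + G i 2 p * X p $ 2"
  by (rule D_eq_g_grad)

lemma mY: "p \<in> W \<Longrightarrow> m p * Y p $ 1 = - D 2 u p" "p \<in> W \<Longrightarrow> m p * Y p $ 2 = D 1 u p"
  by (rule vol_hodge_grad; assumption)+

lemma speed_pos:
  assumes "p \<in> W"
  shows "ginner g c p (X p) (X p) > 0"
proof -
  have "X p \<noteq> 0" using u_noncritical[OF assms] du[OF assms] by auto
  thus ?thesis using g_pos[OF assms] by (simp add: ginner_def)
qed

lemma N_sq: "p \<in> W \<Longrightarrow> (N p)\<^sup>2 = D 1 u p * X p $ 1 + D 2 u p * X p $ 2"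
  using speed_pos[of p] ginner_grad[of p u X] by (simp add: N_def gnorm_def along_def mult.commute)

lemma N_pos: "p \<in> W \<Longrightarrow> N p > 0"
  using speed_pos[of p] by (simp add: N_def gnorm_def)

lemma smooth_X: "smooth (\<lambda>q. X q $ i)"
  by (rule smooth_grad[OF u_smooth])

lemma smooth_Y: "smooth (\<lambda>q. Y q $ i)"
  by (rule smooth_hodge_grad[OF u_smooth])

lemma smooth_N: "smooth N"
proof -
  have "smooth (\<lambda>q. sqrt (ginner g c q (X q) (X q)))"
    by (rule smooth_sqrt) (auto simp: ginner_expand speed_pos[unfolded ginner_expand]
        intro!: smooth_add smooth_mult g_smooth smooth_X)
  thus ?thesis by (simp add: N_def[abs_def] gnorm_def)
qed

lemma smooth_logN: "smooth logN"
  using smooth_ln[OF smooth_N N_pos] by (simp add: logN_def[abs_def])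

lemma smooth_v: "smooth (v i)"
proof -
  have "smooth (\<lambda>q. - (m q * X q $ 2))" "smooth (\<lambda>q. m q * X q $ 1)"
    by (intro smooth_minus smooth_mult smooth_vol smooth_X)+
  thus ?thesis by (cases "i = 1") (simp_all add: v_def[abs_def])
qed

lemma smooth_inverse_N: "smooth (\<lambda>q. 1 / (N q) ^ n)"
  using N_pos by (intro smooth_divide smooth_const smooth_power smooth_N) force

lemma smooth_UV: "smooth (\<lambda>q. U q $ i)" "smooth (\<lambda>q. V q $ i)"
  unfolding U_def V_def vector_scaleR_component real_scaleR_def
  by (intro smooth_mult smooth_inverse_N smooth_X smooth_Y)+

lemma smooth_along_UV: "smooth f \<Longrightarrow> smooth (along U f)" "smooth f \<Longrightarrow> smooth (along V f)"
  by (intro smooth_along smooth_UV; assumption)+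

lemma D_logN: "p \<in> W \<Longrightarrow> D i logN p = D i N p / N p"
  using D_compose[OF smooth_N _ DERIV_ln[OF N_pos]] by (simp add: logN_def[abs_def] divide_inverse)

lemma D_N: "p \<in> W \<Longrightarrow> D i N p = N p * D i logN p"
  using N_pos[of p] by (simp add: D_logN)

lemma D_inverse_N:
  assumes "p \<in> W"
  shows "D i (\<lambda>q. 1 / N q) p = - D i logN p / N p"
proof -
  have "((\<lambda>x. 1 / x) has_real_derivative - (1 / (N p)\<^sup>2)) (at (N p))"
    using N_pos[OF assms] by (auto intro!: derivative_eq_intros simp: power2_eq_square)
  from D_compose[OF smooth_N assms this] show ?thesis
    using N_pos[OF assms] by (simp add: D_N[OF assms] power2_eq_square)
qed

text \<open>In the chart, \<open>d\<star>du\<close> is the Laplacian of \<open>u\<close> times the area element.\<close>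

lemma dv_closed:
  assumes "p \<in> W"
  shows "D 1 (v 2) p = D 2 (v 1) p"
proof -
  have "D 1 (\<lambda>q. m q * X q $ 1) p + D 2 (\<lambda>q. m q * X q $ 2) p = 0"
    using u_harmonic[OF assms] vol_pos[OF assms]
    by (simp add: laplacian_def divergence_def sum_2)
  moreover have "D 2 (\<lambda>q. - (m q * X q $ 2)) p = - D 2 (\<lambda>q. m q * X q $ 2) p"
    by (intro D_minus smooth_mult smooth_vol smooth_X assms)
  ultimately show ?thesis by (simp add: v_def[abs_def])
qed

lemma jacobian_uv:
  "p \<in> W \<Longrightarrow> D 1 u p * v 2 p - D 2 u p * v 1 p = m p * (N p)\<^sup>2"
  by (simp add: N_sq v_simps algebra_simps)

text \<open>The metric is \<open>(du\<^sup>2 + v\<^sup>2) / |\<nabla>u|\<^sup>2\<close>: conformal to the flat one, with conformal factor given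
  by the speed \<open>N\<close>.\<close>

lemma metric_uv:
  assumes "p \<in> W"
  shows "(N p)\<^sup>2 * G i j p = D i u p * D j u p + v i p * v j p"
proof -
  have "(N p)\<^sup>2 * G 1 1 p = D 1 u p * D 1 u p + v 1 p * v 1 p"
    "(N p)\<^sup>2 * G 1 2 p = D 1 u p * D 2 u p + v 1 p * v 2 p"
    "(N p)\<^sup>2 * G 2 2 p = D 2 u p * D 2 u p + v 2 p * v 2 p"
    using du[OF assms, of 1] du[OF assms, of 2] vol_sq[OF assms] N_sq[OF assms] v_simps[of p]
      g_sym[OF assms, of 2 1] by algebra+
  thus ?thesis
    using exhaust_2[of i] exhaust_2[of j] g_sym[OF assms, of 2 1] by (auto simp: mult.commute)
qed

text \<open>That is, \<open>df = U(f) du + V(f) v\<close>, because \<open>U, V\<close> is the frame dual to \<open>du, v\<close>.\<close>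

lemma D_eq_UV:
  assumes "p \<in> W"
  shows "D i f p = D i u p * along U f p + v i p * along V f p"
proof -
  have nz: "m p \<noteq> 0" "N p \<noteq> 0" using vol_pos[OF assms] N_pos[OF assms] by auto
  have UV: "(N p)\<^sup>2 * along U f p = X p $ 1 * D 1 f p + X p $ 2 * D 2 f p"
    "m p * (N p)\<^sup>2 * along V f p = - D 2 u p * D 1 f p + D 1 u p * D 2 f p"
    using nz unfolding mY(1)[OF assms, symmetric] mY(2)[OF assms, symmetric]
    by (simp_all add: along_def U_def V_def field_simps)
  have "(m p * (N p)\<^sup>2) * D i f p = (m p * (N p)\<^sup>2) * (D i u p * along U f p + v i p * along V f p)"
  proof -
    have "i = 1 \<or> i = 2" by (rule exhaust_2)
    thus ?thesis
    proof
      assume i: "i = 1"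
      show ?thesis unfolding i v_simps using UV N_sq[OF assms] by algebra
    next
      assume i: "i = 2"
      show ?thesis unfolding i v_simps using UV N_sq[OF assms] by algebra
    qed
  qed
  with nz show ?thesis by simp
qed

text \<open>Dual frames of closed coframes commute. In detail, \<open>0 = ddf = dU(f) \<and> du + dV(f) \<and> v\<close>;
  expanding \<open>dU(f)\<close> and \<open>dV(f)\<close> once more in \<open>du, v\<close> leaves
  \<open>(U(V f) - V(U f)) du \<and> v\<close>. No derivative of \<open>U\<close> or \<open>V\<close> is ever computed.\<close>

lemma along_UV_commute:
  assumes "p \<in> W" "smooth f"
  shows "along U (along V f) p = along V (along U f) p"
proof -
  let ?P = "along U f" and ?Q = "along V f"
  have D: "D j (D i f) p = D i u p * D j ?P p + D j (D i u) p * ?P p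
      + (v i p * D j ?Q p + D j (v i) p * ?Q p)" for i j
  proof -
    have "D j (D i f) p = D j (\<lambda>q. D i u q * ?P q + v i q * ?Q q) p"
      by (rule D_cong[OF assms(1)]) (rule D_eq_UV)
    thus ?thesis
      using assms u_smooth by (simp add: D_add D_mult smooth_mult smooth_D smooth_v smooth_along_UV)
  qed
  have "(D 1 u p * v 2 p - D 2 u p * v 1 p) * (along U ?Q p - along V ?P p) = 0"
    using D[of 1 2] D[of 2 1] D_commute[OF assms(2,1), of 1 2] D_commute[OF u_smooth assms(1), of 1 2]
      dv_closed[OF assms(1)] D_eq_UV[OF assms(1), of 1 ?P] D_eq_UV[OF assms(1), of 2 ?P]
      D_eq_UV[OF assms(1), of 1 ?Q] D_eq_UV[OF assms(1), of 2 ?Q]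
    by algebra
  thus ?thesis
    using jacobian_uv[OF assms(1)] vol_pos[OF assms(1)] N_pos[OF assms(1)] by simp
qed

lemma grad_eq_UV:
  assumes "p \<in> W"
  shows "grad g c f p = along U f p *\<^sub>R X p + along V f p *\<^sub>R Y p"
proof (rule grad_unique[OF assms])
  fix i
  have "m p * (G i 1 p * Y p $ 1 + G i 2 p * Y p $ 2) = m p * v i p"
  proof -
    have "i = 1 \<or> i = 2" by (rule exhaust_2)
    thus ?thesis
    proof
      assume i: "i = 1"
      show ?thesis unfolding i v_simps
        using du[OF assms, of 1] du[OF assms, of 2] mY[OF assms] vol_sq[OF assms]
          g_sym[OF assms, of 2 1] by algebra
    next
      assume i: "i = 2"
      show ?thesis unfolding i v_simps
        using du[OF assms, of 1] du[OF assms, of 2] mY[OF assms] vol_sq[OF assms]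
          g_sym[OF assms, of 2 1] by algebra
    qed
  qed
  hence v: "v i p = G i 1 p * Y p $ 1 + G i 2 p * Y p $ 2"
    using vol_pos[OF assms] by simp
  show "G i 1 p * (along U f p *\<^sub>R X p + along V f p *\<^sub>R Y p) $ 1
      + G i 2 p * (along U f p *\<^sub>R X p + along V f p *\<^sub>R Y p) $ 2 = D i f p"
    unfolding D_eq_UV[OF assms, of i f] du[OF assms, of i] v
    by (simp add: algebra_simps)
qed

lemma along_X_Y: "p \<in> W \<Longrightarrow> along X f p = (N p)\<^sup>2 * along U f p"
    "p \<in> W \<Longrightarrow> along Y f p = (N p)\<^sup>2 * along V f p"
  using N_pos[of p] by (simp_all add: along_def U_def V_def field_simps)

text \<open>The coordinate expression of the Laplacian for a metric conformal to the flat one. It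
  rests on the fact that \<open>\<nabla>u\<close> and \<open>\<star>\<nabla>u\<close> are both divergence-free.\<close>

lemma laplacian_UV:
  assumes "p \<in> W" "smooth f"
  shows "laplacian g c f p = (N p)\<^sup>2 * (along U (along U f) p + along V (along V f) p)"
proof -
  have "laplacian g c f p = divergence g c (\<lambda>q. along U f q *\<^sub>R X q + along V f q *\<^sub>R Y q) p"
    unfolding laplacian_def by (rule divergence_cong[OF assms(1)]) (rule grad_eq_UV)
  also have "\<dots> = divergence g c (\<lambda>q. along U f q *\<^sub>R X q) p + divergence g c (\<lambda>q. along V f q *\<^sub>R Y q) p"
    using assms by (intro divergence_add)
      (simp_all add: smooth_mult smooth_X smooth_Y smooth_along_UV)
  also have "\<dots> = along X (along U f) p + along Y (along V f) p"
    using assms u_harmonic[OF assms(1)] divergence_hodge_grad[OF assms(1) u_smooth]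
    by (simp add: divergence_scaleR smooth_X smooth_Y smooth_along_UV laplacian_def)
  finally show ?thesis by (simp add: along_X_Y assms algebra_simps)
qed

lemma laplacian_minus:
  assumes "p \<in> W" "smooth f"
  shows "laplacian g c (\<lambda>q. - f q) p = - laplacian g c f p"
proof -
  have "along Z (along Z (\<lambda>q. - f q)) p = - along Z (along Z f) p"
    if Z: "\<And>i. smooth (\<lambda>q. Z q $ i)" for Z
  proof -
    have "along Z (along Z (\<lambda>q. - f q)) p = along Z (\<lambda>q. - along Z f q) p"
      by (rule along_cong[OF assms(1)]) (rule along_minus[OF assms(2)])
    thus ?thesis by (simp add: along_minus smooth_along Z assms)
  qed
  from this[OF smooth_UV(1)] this[OF smooth_UV(2)] show ?thesis
    by (simp add: laplacian_UV[OF assms(1)] smooth_minus assms(2) algebra_simps)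
qed

text \<open>The curvature of \<open>(du\<^sup>2 + v\<^sup>2) / N\<^sup>2\<close>. The orthonormal coframe is \<open>du / N, v / N\<close>; its
  connection form is \<open>\<star>d ln N\<close>, whose exterior derivative is \<open>\<Delta> ln N\<close> times the area form.\<close>

theorem gauss_curvature_eq_laplacian:
  assumes "p \<in> W"
  shows "gauss_curvature g c p = laplacian g c logN p"
proof -
  let ?L = "grad g c logN"
  define e where "e q = 1 / N q" for q
  define a where "a i q = e q * D i u q" for i q
  define b where "b i q = e q * v i q" for i q
  define \<omega> :: "2 \<Rightarrow> 'a \<Rightarrow> real" where
    "\<omega> i q = (if i = 1 then - (m q * ?L q $ 2) else m q * ?L q $ 1)" for i q
  have \<omega>: "\<omega> 1 q = - (m q * ?L q $ 2)" "\<omega> 2 q = m q * ?L q $ 1" for q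
    by (simp_all add: \<omega>_def)
  have e: "smooth e" using smooth_inverse_N[of 1] by (simp add: e_def[abs_def])
  have De: "D k e q = - e q * D k logN q" if "q \<in> W" for k q
    using D_inverse_N[OF that] by (simp add: e_def[abs_def])
  have sL: "smooth (\<lambda>q. m q * ?L q $ i)" for i
    by (intro smooth_mult smooth_vol smooth_grad smooth_logN)
  have dL: "D i logN q = G i 1 q * ?L q $ 1 + G i 2 q * ?L q $ 2" if "q \<in> W" for i q
    by (rule D_eq_g_grad[OF that])
  have da: "D k (a i) q = e q * D k (D i u) q - e q * D k logN q * D i u q"
    and db: "D k (b i) q = e q * D k (v i) q - e q * D k logN q * v i q"
    if "q \<in> W" for i k q
    using D_mult[OF e smooth_D[OF u_smooth] that] D_mult[OF e smooth_v that]
    by (simp_all add: a_def[abs_def] b_def[abs_def] De[OF that])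
  have "gauss_curvature g c p * (a 1 p * b 2 p - a 2 p * b 1 p) = D 1 (\<omega> 2) p - D 2 (\<omega> 1) p"
  proof (rule gauss_curvature_coframe)
    show "smooth (a i)" for i
      unfolding a_def[abs_def] by (intro smooth_mult smooth_D u_smooth e)
    show "smooth (b i)" for i
      unfolding b_def[abs_def] by (intro smooth_mult smooth_v e)
    show "smooth (\<omega> i)" for i
      using sL[of 1] smooth_minus[OF sL[of 2]] by (cases "i = 1") (simp_all add: \<omega>_def[abs_def])
    show "G i j q = a i q * a j q + b i q * b j q" if "q \<in> W" for i j q
      using metric_uv[OF that, of i j] N_pos[OF that]
      by (simp add: a_def b_def e_def field_simps power2_eq_square)
    fix q assume q: "q \<in> W"
    have "D 2 logN q * D 1 u q - D 1 logN q * D 2 u q = m q * (?L q $ 1 * v 1 q + ?L q $ 2 * v 2 q)"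
      unfolding v_simps using du[OF q, of 1] du[OF q, of 2] dL[OF q, of 1] dL[OF q, of 2] vol_sq[OF q]
          g_sym[OF q, of 2 1] by algebra
    thus "D 1 (a 2) q - D 2 (a 1) q = \<omega> 2 q * b 1 q - \<omega> 1 q * b 2 q"
      using D_commute[OF u_smooth q, of 1 2] unfolding da[OF q] b_def \<omega>
      by algebra
    have "v 1 q * D 2 logN q - v 2 q * D 1 logN q = - (m q * (?L q $ 1 * D 1 u q + ?L q $ 2 * D 2 u q))"
      unfolding v_simps using du[OF q, of 1] du[OF q, of 2] dL[OF q, of 1] dL[OF q, of 2]
          g_sym[OF q, of 2 1] by algebra
    thus "D 1 (b 2) q - D 2 (b 1) q = \<omega> 1 q * a 2 q - \<omega> 2 q * a 1 q"
      using dv_closed[OF q] unfolding db[OF q] a_def \<omega>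
      by algebra
  qed (rule assms)
  moreover have "a 1 p * b 2 p - a 2 p * b 1 p = m p"
  proof -
    have "a 1 p * b 2 p - a 2 p * b 1 p = (D 1 u p * v 2 p - D 2 u p * v 1 p) / (N p)\<^sup>2"
      by (simp add: a_def b_def e_def power2_eq_square diff_divide_distrib)
    thus ?thesis using N_pos[OF assms] by (simp add: jacobian_uv[OF assms])
  qed
  moreover have "D 1 (\<omega> 2) p - D 2 (\<omega> 1) p = m p * laplacian g c logN p"
    using vol_pos[OF assms] D_minus[OF sL assms]
    by (simp add: \<omega>_def[abs_def] laplacian_def divergence_def sum_2)
  ultimately show ?thesis using vol_pos[OF assms] by simp
qed

text \<open>Since \<open>\<nabla>u\<close> and \<open>\<star>\<nabla>u\<close> are divergence-free, only the derivative of \<open>1 / N\<close> contributes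
  to either curvature. Hence \<open>k / N = U(ln N)\<close> and \<open>h / N = - V(ln N)\<close>.\<close>

lemma level_curvature_eq:
  assumes "p \<in> W"
  shows "level_curvature g c u p = N p * along U logN p"
proof -
  have inv: "smooth (\<lambda>q. 1 / N q)" using smooth_inverse_N[of 1] by simp
  have "level_curvature g c u p = - along X (\<lambda>q. 1 / N q) p"
    using u_harmonic[OF assms] divergence_scaleR[OF assms inv smooth_X]
    by (simp add: level_curvature_def laplacian_def N_def[symmetric])
  also have "\<dots> = along X logN p / N p"
    by (simp add: along_def D_inverse_N[OF assms] add_divide_distrib)
  finally show ?thesis using N_pos[OF assms] by (simp add: along_X_Y[OF assms] power2_eq_square)
qed

lemma descent_curvature_eq:
  assumes "p \<in> W"
  shows "descent_curvature g c u p = - (N p * along V logN p)"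
proof -
  have inv: "smooth (\<lambda>q. 1 / N q)" using smooth_inverse_N[of 1] by simp
  have "descent_curvature g c u p = along Y (\<lambda>q. 1 / N q) p"
    using divergence_hodge_grad[OF assms u_smooth] divergence_scaleR[OF assms inv smooth_Y]
    by (simp add: descent_curvature_def N_def[symmetric])
  also have "\<dots> = - (along Y logN p / N p)"
    by (simp add: along_def D_inverse_N[OF assms] add_divide_distrib)
  finally show ?thesis using N_pos[OF assms] by (simp add: along_X_Y[OF assms] power2_eq_square)
qed

text \<open>\<open>U\<close> and \<open>V\<close> do not commute with the Laplacian \<open>N\<^sup>2 (UU + VV)\<close>, but they do commute with
  \<open>UU + VV\<close>, and \<open>(UU + VV)(ln N) = K / N\<^sup>2\<close>. Differentiating the right-hand side produces the two terms.\<close>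

lemma laplacian_along_log_speed:
  assumes "p \<in> W"
  shows "laplacian g c (along U logN) p
      = along U (gauss_curvature g c) p - 2 * gauss_curvature g c p * along U logN p"
    and "laplacian g c (along V logN) p
      = along V (gauss_curvature g c) p - 2 * gauss_curvature g c p * along V logN p"
proof -
  let ?K = "gauss_curvature g c"
  define \<kappa> where "\<kappa> q = along U (along U logN) q + along V (along V logN) q" for q
  have sm: "smooth logN" "smooth (along U logN)" "smooth (along V logN)"
      "smooth (along U (along U logN))" "smooth (along V (along V logN))"
    by (intro smooth_along_UV smooth_logN)+
  have s\<kappa>: "smooth \<kappa>" unfolding \<kappa>_def[abs_def] by (intro smooth_add sm)
  have s2: "smooth (\<lambda>q. N q * N q)" by (intro smooth_mult smooth_N)
  have K: "?K q = N q * N q * \<kappa> q" if "q \<in> W" for q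
    using laplacian_UV[OF that smooth_logN]
    by (simp add: gauss_curvature_eq_laplacian[OF that] \<kappa>_def power2_eq_square)
  have dN: "along Z N p = N p * along Z logN p" for Z
    by (simp add: along_def D_N[OF assms] algebra_simps)
  have dK: "along Z ?K p = (N p)\<^sup>2 * along Z \<kappa> p + 2 * ?K p * along Z logN p" for Z
  proof -
    have "along Z ?K p = along Z (\<lambda>q. N q * N q * \<kappa> q) p"
      by (rule along_cong[OF assms]) (rule K)
    also have "\<dots> = (N p)\<^sup>2 * along Z \<kappa> p + 2 * (N p * N p * \<kappa> p) * along Z logN p"
      using along_mult[OF s2 s\<kappa> assms] along_mult[OF smooth_N smooth_N assms]
      by (simp add: dN power2_eq_square algebra_simps)
    finally show ?thesis by (simp add: K[OF assms])
  qed
  have "along U \<kappa> p = along U (along U (along U logN)) p + along U (along V (along V logN)) p"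
    "along V \<kappa> p = along V (along U (along U logN)) p + along V (along V (along V logN)) p"
    unfolding \<kappa>_def[abs_def] by (intro along_add sm assms)+
  moreover have "along U (along V (along V logN)) p = along V (along V (along U logN)) p"
    using along_UV_commute[OF assms sm(3)] along_cong[OF assms along_UV_commute[OF _ sm(1)], where Z = V]
    by simp
  moreover have "along V (along U (along U logN)) p = along U (along U (along V logN)) p"
    using along_UV_commute[OF assms sm(2)] along_cong[OF assms along_UV_commute[OF _ sm(1)], where Z = U]
    by simp
  ultimately have "laplacian g c (along U logN) p = (N p)\<^sup>2 * along U \<kappa> p"
    "laplacian g c (along V logN) p = (N p)\<^sup>2 * along V \<kappa> p"
    by (simp_all add: laplacian_UV[OF assms sm(2)] laplacian_UV[OF assms sm(3)])
  thus "laplacian g c (along U logN) p = along U ?K p - 2 * ?K p * along U logN p"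
    "laplacian g c (along V logN) p = along V ?K p - 2 * ?K p * along V logN p"
    by (simp_all add: dK)
qed

text \<open>\<open>\<Delta> ln |f| = \<Delta>f / f - |\<nabla>f|\<^sup>2 / f\<^sup>2\<close>; dropping the last term is the only loss in the
  inequalities of the theorem.\<close>

lemma laplacian_ln_abs_le:
  assumes "smooth f" "\<And>q. q \<in> W \<Longrightarrow> f q \<noteq> 0" and p: "p \<in> W"
  shows "laplacian g c (\<lambda>q. ln \<bar>f q\<bar>) p \<le> laplacian g c f p / f p"
proof -
  have second: "along Z (along Z (\<lambda>q. ln \<bar>f q\<bar>)) p
      = along Z (along Z f) p / f p - (along Z f p / f p)\<^sup>2"
    if Z: "\<And>i. smooth (\<lambda>q. Z q $ i)" for Z
  proof -
    have inv: "smooth (\<lambda>q. inverse (f q))" by (rule smooth_inverse[OF assms(1,2)])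
    have "along Z (along Z (\<lambda>q. ln \<bar>f q\<bar>)) p = along Z (\<lambda>q. along Z f q * inverse (f q)) p"
      by (rule along_cong[OF p]) (simp add: along_ln_abs assms divide_inverse)
    also have "\<dots> = along Z f p * along Z (\<lambda>q. inverse (f q)) p + along Z (along Z f) p * inverse (f p)"
      by (intro along_mult smooth_along Z assms(1) inv p)
    also have "along Z (\<lambda>q. inverse (f q)) p = - (inverse (f p) * inverse (f p)) * along Z f p"
      using along_compose[OF assms(1) p DERIV_inverse[OF assms(2)[OF p]]] by (simp add: numeral_2_eq_2)
    finally show ?thesis by (simp add: divide_inverse power2_eq_square)
  qed
  have "laplacian g c (\<lambda>q. ln \<bar>f q\<bar>) p
      = laplacian g c f p / f p - (N p)\<^sup>2 * ((along U f p / f p)\<^sup>2 + (along V f p / f p)\<^sup>2)"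
    using laplacian_UV[OF p smooth_ln_abs[OF assms(1,2)]] laplacian_UV[OF p assms(1)]
      second[OF smooth_UV(1)] second[OF smooth_UV(2)]
    by (simp add: add_divide_distrib algebra_simps)
  thus ?thesis by simp
qed

text \<open>Both curvatures are \<open>N\<close> times a derivative of \<open>ln N\<close>, and the factor \<open>N\<close> contributes
  \<open>\<Delta> ln N = K\<close>.\<close>

lemma laplacian_ln_abs_speed_mult_le:
  assumes "smooth f" "\<And>q. q \<in> W \<Longrightarrow> f q \<noteq> 0" and p: "p \<in> W"
  shows "laplacian g c (\<lambda>q. ln \<bar>N q * f q\<bar>) p \<le> gauss_curvature g c p + laplacian g c f p / f p"
proof -
  have sm: "smooth (\<lambda>q. ln \<bar>f q\<bar>)" by (rule smooth_ln_abs[OF assms(1,2)])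
  have "laplacian g c (\<lambda>q. ln \<bar>N q * f q\<bar>) p = laplacian g c (\<lambda>q. logN q + ln \<bar>f q\<bar>) p"
  proof (rule laplacian_cong[OF p])
    fix q assume "q \<in> W"
    thus "ln \<bar>N q * f q\<bar> = logN q + ln \<bar>f q\<bar>"
      using N_pos[of q] assms(2)[of q] by (simp add: abs_mult ln_mult logN_def)
  qed
  also have "\<dots> = laplacian g c logN p + laplacian g c (\<lambda>q. ln \<bar>f q\<bar>) p"
  proof -
    have "along Z (along Z (\<lambda>q. logN q + ln \<bar>f q\<bar>)) p
        = along Z (along Z logN) p + along Z (along Z (\<lambda>q. ln \<bar>f q\<bar>)) p"
      if Z: "\<And>i. smooth (\<lambda>q. Z q $ i)" for Z
    proof -
      have "along Z (along Z (\<lambda>q. logN q + ln \<bar>f q\<bar>)) p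
          = along Z (\<lambda>q. along Z logN q + along Z (\<lambda>q. ln \<bar>f q\<bar>) q) p"
        by (rule along_cong[OF p]) (rule along_add[OF smooth_logN sm])
      thus ?thesis by (simp add: along_add smooth_along Z smooth_logN sm p)
    qed
    from this[OF smooth_UV(1)] this[OF smooth_UV(2)] show ?thesis
      using laplacian_UV[OF p smooth_add[OF smooth_logN sm]] laplacian_UV[OF p smooth_logN]
        laplacian_UV[OF p sm] by (simp add: algebra_simps)
  qed
  finally show ?thesis
    using laplacian_ln_abs_le[OF assms] by (simp add: gauss_curvature_eq_laplacian[OF p])
qed

lemma smooth_curvatures: "smooth (level_curvature g c u)" "smooth (descent_curvature g c u)"
proof -
  have "smooth (\<lambda>q. N q * along U logN q)" "smooth (\<lambda>q. - (N q * along V logN q))"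
    by (intro smooth_minus smooth_mult smooth_N smooth_along_UV smooth_logN)+
  thus "smooth (level_curvature g c u)" "smooth (descent_curvature g c u)"
    using smooth_cong[OF level_curvature_eq] smooth_cong[OF descent_curvature_eq] by simp_all
qed

lemma laplacian_level_curvature:
  assumes "p \<in> W"
  shows "laplacian g c (\<lambda>q. level_curvature g c u q / N q) p
      + 2 * gauss_curvature g c p * (level_curvature g c u p / N p)
    = ginner g c p (grad g c (gauss_curvature g c) p) (X p) / (N p)\<^sup>2"
proof -
  have \<phi>: "level_curvature g c u q / N q = along U logN q" if "q \<in> W" for q
    using N_pos[OF that] by (simp add: level_curvature_eq[OF that])
  have "laplacian g c (\<lambda>q. level_curvature g c u q / N q) p = laplacian g c (along U logN) p"
    by (rule laplacian_cong[OF assms]) (rule \<phi>)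
  thus ?thesis
    using N_pos[OF assms]
    by (simp add: \<phi>[OF assms] laplacian_along_log_speed[OF assms] ginner_grad[OF assms]
        along_X_Y[OF assms])
qed

lemma laplacian_descent_curvature:
  assumes "p \<in> W"
  shows "laplacian g c (\<lambda>q. descent_curvature g c u q / N q) p
      + 2 * gauss_curvature g c p * (descent_curvature g c u p / N p)
    = - ginner g c p (grad g c (gauss_curvature g c) p) (Y p) / (N p)\<^sup>2"
proof -
  have \<psi>: "descent_curvature g c u q / N q = - along V logN q" if "q \<in> W" for q
    using N_pos[OF that] by (simp add: descent_curvature_eq[OF that])
  have "laplacian g c (\<lambda>q. descent_curvature g c u q / N q) p
      = laplacian g c (\<lambda>q. - along V logN q) p"
    by (rule laplacian_cong[OF assms]) (rule \<psi>)
  also have "\<dots> = - laplacian g c (along V logN) p"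
    by (rule laplacian_minus[OF assms smooth_along_UV(2)[OF smooth_logN]])
  finally show ?thesis
    using N_pos[OF assms] ginner_grad[OF assms, where Z = Y]
    by (simp add: \<psi>[OF assms] laplacian_along_log_speed[OF assms] along_X_Y[OF assms])
qed

lemma laplacian_ln_level_curvature:
  assumes "\<And>q. q \<in> W \<Longrightarrow> level_curvature g c u q \<noteq> 0" and p: "p \<in> W"
  shows "- laplacian g c (\<lambda>q. ln \<bar>level_curvature g c u q\<bar>) p
    \<ge> gauss_curvature g c p - 1 / level_curvature g c u p
      * ginner g c p (grad g c (gauss_curvature g c) p) ((1 / N p) *\<^sub>R X p)"
proof -
  have nz: "along U logN q \<noteq> 0" if "q \<in> W" for q
    using assms(1)[OF that] by (simp add: level_curvature_eq[OF that])
  have "laplacian g c (\<lambda>q. ln \<bar>level_curvature g c u q\<bar>) p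
      = laplacian g c (\<lambda>q. ln \<bar>N q * along U logN q\<bar>) p"
    by (rule laplacian_cong[OF p]) (simp add: level_curvature_eq)
  also have "\<dots> \<le> gauss_curvature g c p + laplacian g c (along U logN) p / along U logN p"
    by (rule laplacian_ln_abs_speed_mult_le[OF smooth_along_UV(1)[OF smooth_logN] nz p])
  finally show ?thesis
    using nz[OF p] N_pos[OF p] ginner_grad[OF p, of _ X]
    by (simp add: laplacian_along_log_speed[OF p] level_curvature_eq[OF p] ginner_scaleR
        along_X_Y[OF p] diff_divide_distrib power2_eq_square)
qed

lemma laplacian_ln_descent_curvature:
  assumes "\<And>q. q \<in> W \<Longrightarrow> descent_curvature g c u q \<noteq> 0" and p: "p \<in> W"
  shows "- laplacian g c (\<lambda>q. ln \<bar>descent_curvature g c u q\<bar>) p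
    \<ge> gauss_curvature g c p + 1 / descent_curvature g c u p
      * ginner g c p (grad g c (gauss_curvature g c) p) ((1 / N p) *\<^sub>R Y p)"
proof -
  have nz: "along V logN q \<noteq> 0" if "q \<in> W" for q
    using assms(1)[OF that] by (simp add: descent_curvature_eq[OF that])
  have "laplacian g c (\<lambda>q. ln \<bar>descent_curvature g c u q\<bar>) p
      = laplacian g c (\<lambda>q. ln \<bar>N q * along V logN q\<bar>) p"
    by (rule laplacian_cong[OF p]) (simp add: descent_curvature_eq)
  also have "\<dots> \<le> gauss_curvature g c p + laplacian g c (along V logN) p / along V logN p"
    by (rule laplacian_ln_abs_speed_mult_le[OF smooth_along_UV(2)[OF smooth_logN] nz p])
  finally show ?thesis
    using nz[OF p] N_pos[OF p] ginner_grad[OF p, where Z = Y]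
    by (simp add: laplacian_along_log_speed[OF p] descent_curvature_eq[OF p] ginner_scaleR
        along_X_Y[OF p] diff_divide_distrib power2_eq_square)
qed

end

section \<open>From the surface to a chart\<close>

lemma harmonic_patchI:
  assumes S: "riemannian_surface M A g"
    and harm: "harmonic_on A g \<Omega> u"
    and crit: "\<forall>p\<in>\<Omega>. \<not> critical_point A u p"
    and c: "c \<in> A" and W: "W \<subseteq> \<Omega> \<inter> cdom c" "open (cmap c ` W)"
  shows "harmonic_patch c W g u"
proof
  interpret riemannian_surface M A g by (rule S)
  show "W \<subseteq> cdom c" "open (cmap c ` W)" using W by auto
  have "cdom c \<subseteq> topspace M" using chart_dom_open[OF c] by (rule openin_subset)
  thus "inj_on (cmap c) (cdom c)"
    using homeomorphic_imp_injective_map[OF chart_homeomorphic[OF c]]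
    by (simp add: topspace_subtopology Int_absorb1)
  have sub: "smooth_in_chart c W f" if "smooth_in_chart c W' f" "W \<subseteq> W'"
    for f :: "'a \<Rightarrow> 'c::real_normed_vector" and W'
    using that(1) unfolding smooth_in_chart_def smooth_on_def
    by (meson Ck_on_subset that(2) image_mono Int_mono order_refl)
  show "smooth_in_chart c W u" using harm c W by (intro sub[of \<Omega>]) (auto simp: harmonic_on_def)
  show "smooth_in_chart c W (\<lambda>q. g c q $ i $ j)" for i j
  proof -
    have "smooth_in_chart c W (g c)" using metric_smooth[OF c] W by (intro sub[of "cdom c"]) auto
    hence "Ck_on n (cmap c ` W) (\<lambda>x. (g c (chart_inv c x)))" for n
      using W(1) by (simp add: smooth_in_chart_def smooth_on_def comp_def Int_absorb2)
    moreover have "bounded_linear (\<lambda>B :: real^2^2. B $ i $ j)"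
      by (rule bounded_linear_compose[OF bounded_linear_vec_nth bounded_linear_vec_nth])
    ultimately have "Ck_on n (cmap c ` W) (\<lambda>x. g c (chart_inv c x) $ i $ j)" for n
      using Ck_on_bounded_linear[OF W(2)] by blast
    thus ?thesis
      using W(1) by (simp add: smooth_in_chart_def smooth_on_def comp_def Int_absorb2)
  qed
  fix p assume "p \<in> W"
  hence p: "p \<in> \<Omega>" "p \<in> cdom c" using W by auto
  show "g c p $ i $ j = g c p $ j $ i" for i j
  proof -
    have "transpose (g c p) $ j $ i = g c p $ j $ i" by (simp add: metric_symmetric[OF c p(2)])
    thus ?thesis by (simp add: transpose_def)
  qed
  show "X \<bullet> (g c p *v X) > 0" if "X \<noteq> 0" for X
    using metric_positive[OF c p(2) that] .
  show "laplacian g c u p = 0" using harm c p by (auto simp: harmonic_on_def)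
  show "\<exists>i. pd c i u p \<noteq> 0" using crit c p by (auto simp: critical_point_def)
qed

lemma (in riemannian_surface) open_chart_image:
  assumes "c \<in> A" "openin M \<Omega>"
  shows "open (cmap c ` (\<Omega> \<inter> cdom c))"
proof -
  have "openin (subtopology M (cdom c)) (\<Omega> \<inter> cdom c)"
    using assms(2) by (auto simp: openin_subtopology)
  hence "openin (top_of_set (cmap c ` cdom c)) (cmap c ` (\<Omega> \<inter> cdom c))"
    using homeomorphic_imp_open_map[OF chart_homeomorphic[OF assms(1)]] by (simp add: open_map_def)
  thus ?thesis using chart_image_open[OF assms(1)] openin_open_trans by blast
qed

theorem theorem4p2:
  fixes M :: "'a topology"
    and A :: "'a chart set"
    and g :: "'a chart \<Rightarrow> 'a \<Rightarrow> real^2^2"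
    and \<Omega> :: "'a set"
    and u :: "'a \<Rightarrow> real"
  assumes "riemannian_surface M A g"
    and "openin M \<Omega>" and "connectedin M \<Omega>" and "\<Omega> \<noteq> {}"
    and "harmonic_on A g \<Omega> u"
    and "\<forall>p\<in>\<Omega>. \<not> critical_point A u p"
  shows "\<forall>c\<in>A. \<forall>p\<in>\<Omega> \<inter> cdom c.
    (let K = gauss_curvature g c;
         k = level_curvature g c u;
         h = descent_curvature g c u;
         N = (\<lambda>q. gnorm g c q (grad g c u q));
         \<phi> = (\<lambda>q. k q / N q);
         \<psi> = (\<lambda>q. h q / N q)
     in laplacian g c \<phi> p + 2 * K p * \<phi> p
          = ginner g c p (grad g c K p) (grad g c u p) / (N p)\<^sup>2
      \<and> laplacian g c \<psi> p + 2 * K p * \<psi> p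
          = - ginner g c p (grad g c K p) (hodge g c p (grad g c u p)) / (N p)\<^sup>2
      \<and> (k p \<noteq> 0 \<longrightarrow>
          - laplacian g c (\<lambda>q. ln \<bar>k q\<bar>) p
            \<ge> K p - 1 / k p * ginner g c p (grad g c K p) ((1 / N p) *\<^sub>R grad g c u p))
      \<and> (h p \<noteq> 0 \<longrightarrow>
          - laplacian g c (\<lambda>q. ln \<bar>h q\<bar>) p
            \<ge> K p + 1 / h p * ginner g c p (grad g c K p)
                        ((1 / N p) *\<^sub>R hodge g c p (grad g c u p))))"
proof (intro ballI)
  fix c p assume c: "c \<in> A" and p: "p \<in> \<Omega> \<inter> cdom c"
  let ?W = "\<Omega> \<inter> cdom c"
  note patch = harmonic_patchI[OF assms(1,5,6) c]
  interpret W: harmonic_patch c ?W g u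
    by (rule patch) (use riemannian_surface.open_chart_image[OF assms(1) c assms(2)] in auto)
  \<comment> \<open>The Laplacian of \<open>ln |k|\<close> at \<open>p\<close> depends only on the part of \<open>W\<close> where \<open>k\<close> does not vanish,
    and the smaller set is again a patch on which \<open>u\<close> is harmonic.\<close>
  have k: "- laplacian g c (\<lambda>q. ln \<bar>level_curvature g c u q\<bar>) p
      \<ge> gauss_curvature g c p - 1 / level_curvature g c u p
        * ginner g c p (grad g c (gauss_curvature g c) p) ((1 / W.N p) *\<^sub>R grad g c u p)"
    if "level_curvature g c u p \<noteq> 0"
  proof -
    have "harmonic_patch c {q \<in> ?W. level_curvature g c u q \<noteq> 0} g u"
      by (rule patch[OF _ W.open_nonzero[OF W.smooth_curvatures(1)]]) auto
    from harmonic_patch.laplacian_ln_level_curvature[OF this, of p] show ?thesis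
      using p that by (simp add: W.N_def harmonic_patch.N_def[OF \<open>harmonic_patch c _ g u\<close>])
  qed
  have h: "- laplacian g c (\<lambda>q. ln \<bar>descent_curvature g c u q\<bar>) p
      \<ge> gauss_curvature g c p + 1 / descent_curvature g c u p
        * ginner g c p (grad g c (gauss_curvature g c) p)
            ((1 / W.N p) *\<^sub>R hodge g c p (grad g c u p))"
    if "descent_curvature g c u p \<noteq> 0"
  proof -
    have "harmonic_patch c {q \<in> ?W. descent_curvature g c u q \<noteq> 0} g u"
      by (rule patch[OF _ W.open_nonzero[OF W.smooth_curvatures(2)]]) auto
    from harmonic_patch.laplacian_ln_descent_curvature[OF this, of p] show ?thesis
      using p that by (simp add: W.N_def harmonic_patch.N_def[OF \<open>harmonic_patch c _ g u\<close>])
  qed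
  show "(let K = gauss_curvature g c;
         k = level_curvature g c u;
         h = descent_curvature g c u;
         N = (\<lambda>q. gnorm g c q (grad g c u q));
         \<phi> = (\<lambda>q. k q / N q);
         \<psi> = (\<lambda>q. h q / N q)
     in laplacian g c \<phi> p + 2 * K p * \<phi> p
          = ginner g c p (grad g c K p) (grad g c u p) / (N p)\<^sup>2
      \<and> laplacian g c \<psi> p + 2 * K p * \<psi> p
          = - ginner g c p (grad g c K p) (hodge g c p (grad g c u p)) / (N p)\<^sup>2
      \<and> (k p \<noteq> 0 \<longrightarrow>
          - laplacian g c (\<lambda>q. ln \<bar>k q\<bar>) p
            \<ge> K p - 1 / k p * ginner g c p (grad g c K p) ((1 / N p) *\<^sub>R grad g c u p))
      \<and> (h p \<noteq> 0 \<longrightarrow>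
          - laplacian g c (\<lambda>q. ln \<bar>h q\<bar>) p
            \<ge> K p + 1 / h p * ginner g c p (grad g c K p)
                        ((1 / N p) *\<^sub>R hodge g c p (grad g c u p))))"
    unfolding Let_def W.N_def[symmetric]
    using W.laplacian_level_curvature[OF p] W.laplacian_descent_curvature[OF p] k h by blast
qed

end
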